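(* For every $f\in Z^2(G,S^* )$, there exist a $2$-cocycle $h\in Z^2(G,L^* )$ and $r\in Sl(G)$ such that $fh=b_r$ with $0\leq v_{\pi}(h(\sigma,\sigma^{-1}))\leq 1$ for all $\sigma\in G$.
   Context: Standing assumptions: $R$ is a complete discrete valuation ring with quotient field $K$, $L$ is a finite Galois extension of $K$ with Galois group $G$, unramified with finite residue field; $S$ is the integral closure of $R$ in $L$, $\pi S$ its unique maximal ideal (with $\pi$ a fixed generator), $L^*=L\setminus\{0\}$, $S^*=S\setminus\{0\}$, and $U(S)$ the group of units of $S$. $v_\pi$ is the $\pi S$-adic valuation, extended to $L$. The function $u:G\to U(S)$ is defined by $\sigma(\pi)=u(\sigma)\pi$. For $\sigma\in G$ and $l\in L$ write $l^\sigma=\sigma(l)$. $Z^2(G,L^* )$ (resp. $Z^2(G,S^* )$) is the set of normalized $2$-cocycles of $G$ on $L^*$ (resp. normalized weak $2$-cocycles of $G$ on $S^*$), i.e. functions $f$ from $G\times G$ to $L^*$ (resp. to $S^*$) with $f(\sigma,\tau)f(\sigma\tau,\rho)=f(\tau,\rho)^{\sigma}f(\sigma,\tau\rho)$ for all $\sigma,\tau,\rho\in G$ and $f(1,\sigma)=f(\sigma,1)=1$ for all $\sigma\in G$. Products of cocycles are pointwise. $Sl(G)$ is the set of all functions $r:G\to\mathbb{N}$ (with $0\in\mathbb{N}$) satisfying $r(1)=0$ and $r(\sigma\tau)\leq r(\sigma)+r(\tau)$ for all $\sigma,\tau\in G$. For $r\in Sl(G)$, $b_r:G\times G\to S^*$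 is defined by $b_r(\sigma,\tau)=u(\sigma)^{r(\tau)}\pi^{r(\sigma)+r(\tau)-r(\sigma\tau)}$. *)

theory Defs
  imports "HOL-Algebra.Algebra" "HOL-Algebra.Bij" "HOL-Algebra.Finite_Extensions"
begin

section \<open>Galois extensions inside an ambient field\<close>

text \<open>An irreducible polynomial has only simple roots as soon as it has one simple root, so
  it is enough to look at the multiplicity of \<open>x\<close> itself in its minimal polynomial.\<close>

definition (in ring) separable_over :: "'a set \<Rightarrow> 'a \<Rightarrow> bool" where
  "separable_over K x \<longleftrightarrow> (algebraic over K) x \<and> alg_mult (Irr K x) x = 1"

definition (in ring) finite_galois_over :: "'a set \<Rightarrow> bool" where
  "finite_galois_over K \<longleftrightarrow>
     finite_dimension K (carrier R) \<and>
     (\<forall>x \<in> carrier R. separable_over K x \<and> splitted (Irr K x))"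

text \<open>As in \<^const>\<open>BijGroup\<close>, automorphisms are taken extensional on \<^term>\<open>carrier L\<close>;
  the product of \<open>\<sigma>\<close> and \<open>\<tau>\<close> is \<open>x \<mapsto> \<sigma> (\<tau> x)\<close>.\<close>

definition galois_group :: "('a, 'b) ring_scheme \<Rightarrow> 'a set \<Rightarrow> ('a \<Rightarrow> 'a) monoid" where
  "galois_group L K = BijGroup (carrier L)
     \<lparr>carrier := {\<sigma> \<in> ring_iso L L \<inter> Bij (carrier L). \<forall>k \<in> K. \<sigma> k = k}\<rparr>"


section \<open>Discrete valuation rings and integral closure\<close>

definition discrete_valuation_ring :: "('a, 'b) ring_scheme \<Rightarrow> bool" where
  "discrete_valuation_ring A \<longleftrightarrow>
     principal_domain A \<and> \<not> field A \<and> (\<exists>!m. maximalideal m A)"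

text \<open>Powers of ideals are powers in the multiplicative monoid of \<^term>\<open>ideals_set A\<close>.\<close>

definition adically_complete :: "('a, 'b) ring_scheme \<Rightarrow> 'a set \<Rightarrow> bool" where
  "adically_complete A I \<longleftrightarrow>
     (\<forall>x :: nat \<Rightarrow> 'a.
        (\<forall>i. x i \<in> carrier A) \<and>
        (\<forall>n::nat. \<exists>N. \<forall>i\<ge>N. \<forall>j\<ge>N. x i \<ominus>\<^bsub>A\<^esub> x j \<in> I [^]\<^bsub>ideals_set A\<^esub> n) \<longrightarrow>
        (\<exists>l \<in> carrier A. \<forall>n::nat. \<exists>N. \<forall>i\<ge>N. x i \<ominus>\<^bsub>A\<^esub> l \<in> I [^]\<^bsub>ideals_set A\<^esub> n))"

definition complete_discrete_valuation_ring :: "('a, 'b) ring_scheme \<Rightarrow> bool" where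
  "complete_discrete_valuation_ring A \<longleftrightarrow>
     discrete_valuation_ring A \<and> (\<forall>m. maximalideal m A \<longrightarrow> adically_complete A m)"

definition quotient_field_in :: "('a, 'b) ring_scheme \<Rightarrow> 'a set \<Rightarrow> 'a set" where
  "quotient_field_in L R = {a \<otimes>\<^bsub>L\<^esub> inv\<^bsub>L\<^esub> b | a b. a \<in> R \<and> b \<in> R - {\<zero>\<^bsub>L\<^esub>}}"

definition integral_closure_in :: "('a, 'b) ring_scheme \<Rightarrow> 'a set \<Rightarrow> 'a set" where
  "integral_closure_in L R =
     {x \<in> carrier L. \<exists>p \<in> carrier (R [X]\<^bsub>L\<^esub>).
        p \<noteq> [] \<and> lead_coeff p = \<one>\<^bsub>L\<^esub> \<and> ring.eval L p x = \<zero>\<^bsub>L\<^esub>}"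

text \<open>For local rings \<open>A \<subseteq> B\<close> with the same operations: ramification index one and separable
  residue field extension. The residue field of \<open>A\<close> is viewed as its image in that of \<open>B\<close>.\<close>

definition unramified_extension :: "('a, 'b) ring_scheme \<Rightarrow> ('a, 'b) ring_scheme \<Rightarrow> bool" where
  "unramified_extension A B \<longleftrightarrow>
     (\<forall>m M. maximalideal m A \<and> maximalideal M B \<longrightarrow>
        Idl\<^bsub>B\<^esub> m = M \<and>
        (\<forall>x \<in> carrier (B Quot M).
           ring.separable_over (B Quot M) ((\<lambda>a. M +>\<^bsub>B\<^esub> a) ` carrier A) x))"

definition adic_val :: "('a, 'b) ring_scheme \<Rightarrow> 'a set \<Rightarrow> 'a \<Rightarrow> nat" where
  "adic_val A I x = (GREATEST n. x \<in> I [^]\<^bsub>ideals_set A\<^esub> n)"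

text \<open>Extension of the \<open>\<pi>S\<close>-adic valuation of \<open>S\<close> to quotients; meaningful on nonzero
  arguments only.\<close>

definition val :: "('a, 'b) ring_scheme \<Rightarrow> 'a set \<Rightarrow> 'a \<Rightarrow> 'a \<Rightarrow> int" where
  "val L S \<pi> x = (let B = L\<lparr>carrier := S\<rparr>; v = adic_val B (PIdl\<^bsub>B\<^esub> \<pi>) in
     THE k. \<exists>a \<in> S - {\<zero>\<^bsub>L\<^esub>}. \<exists>b \<in> S - {\<zero>\<^bsub>L\<^esub>}.
       x = a \<otimes>\<^bsub>L\<^esub> inv\<^bsub>L\<^esub> b \<and> k = int (v a) - int (v b))"


section \<open>Weak cocycles\<close>

text \<open>Cochains are constrained only on \<^term>\<open>carrier G\<close>.\<close>

definition Z2 :: "('a \<Rightarrow> 'a) monoid \<Rightarrow> ('a, 'b) ring_scheme \<Rightarrow> 'a set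
    \<Rightarrow> (('a \<Rightarrow> 'a) \<Rightarrow> ('a \<Rightarrow> 'a) \<Rightarrow> 'a) set" where
  "Z2 G L M = {f.
     (\<forall>\<sigma> \<in> carrier G. \<forall>\<tau> \<in> carrier G. f \<sigma> \<tau> \<in> M) \<and>
     (\<forall>\<sigma> \<in> carrier G. \<forall>\<tau> \<in> carrier G. \<forall>\<rho> \<in> carrier G.
        f \<sigma> \<tau> \<otimes>\<^bsub>L\<^esub> f (\<sigma> \<otimes>\<^bsub>G\<^esub> \<tau>) \<rho> = \<sigma> (f \<tau> \<rho>) \<otimes>\<^bsub>L\<^esub> f \<sigma> (\<tau> \<otimes>\<^bsub>G\<^esub> \<rho>)) \<and>
     (\<forall>\<sigma> \<in> carrier G. f \<one>\<^bsub>G\<^esub> \<sigma> = \<one>\<^bsub>L\<^esub> \<and> f \<sigma> \<one>\<^bsub>G\<^esub> = \<one>\<^bsub>L\<^esub>)}"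

definition Sl :: "('g, 'c) monoid_scheme \<Rightarrow> ('g \<Rightarrow> nat) set" where
  "Sl G = {r. r \<one>\<^bsub>G\<^esub> = 0 \<and>
     (\<forall>\<sigma> \<in> carrier G. \<forall>\<tau> \<in> carrier G. r (\<sigma> \<otimes>\<^bsub>G\<^esub> \<tau>) \<le> r \<sigma> + r \<tau>)}"

definition u :: "('a, 'b) ring_scheme \<Rightarrow> 'a \<Rightarrow> ('a \<Rightarrow> 'a) \<Rightarrow> 'a" where
  "u L \<pi> \<sigma> = \<sigma> \<pi> \<otimes>\<^bsub>L\<^esub> inv\<^bsub>L\<^esub> \<pi>"

text \<open>For \<open>r\<close> in \<^term>\<open>Sl G\<close> the subtraction of natural numbers does not truncate.\<close>

definition b_cocycle :: "('a \<Rightarrow> 'a) monoid \<Rightarrow> ('a, 'b) ring_scheme \<Rightarrow> 'a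
    \<Rightarrow> (('a \<Rightarrow> 'a) \<Rightarrow> nat) \<Rightarrow> ('a \<Rightarrow> 'a) \<Rightarrow> ('a \<Rightarrow> 'a) \<Rightarrow> 'a" where
  "b_cocycle G L \<pi> r \<sigma> \<tau> =
     u L \<pi> \<sigma> [^]\<^bsub>L\<^esub> r \<tau> \<otimes>\<^bsub>L\<^esub> \<pi> [^]\<^bsub>L\<^esub> (r \<sigma> + r \<tau> - r (\<sigma> \<otimes>\<^bsub>G\<^esub> \<tau>))"

end

theory Submission
  imports Defs
begin

text \<open>For every \<open>r\<close> in \<open>Sl(G)\<close> the map \<open>b\<^sub>r\<close> is a coboundary in \<open>L\<^sup>*\<close>, so \<open>h = b\<^sub>r / f\<close> is
  automatically a cocycle and only the valuations have to be controlled. Since the valuation is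
  Galois invariant, \<open>a = v \<circ> f\<close> is a cocycle with values in the trivial module \<open>\<int>\<close>, hence the
  coboundary of \<open>\<sigma> \<mapsto> (\<Sum>\<rho>. a \<sigma> \<rho>) / |G|\<close>. Rounding this cochain up gives a subadditive \<open>r\<close> with
  \<open>r(\<sigma>) + r(\<sigma>\<inverse>) - a(\<sigma>, \<sigma>\<inverse>)\<close> equal to 0 or 1.\<close>

section \<open>Uniformizers\<close>

text \<open>The hypotheses describe \<open>S\<close> only as an integral closure whose one maximal
  ideal is generated by \<open>\<pi>\<close>, so a usable valuation has to be built first.
  Unramifiedness is the key: it puts a generator \<open>t\<close> of that ideal into
  \<open>R\<close>. Since \<open>G\<close> fixes \<open>t\<close>, automorphisms preserve the normal
  form "power of \<open>t\<close> times unit", and Galois invariance of the valuation follows at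
  once. Since \<open>\<pi>\<close> is a unit multiple of \<open>t\<close>, each
  \<open>u(\<sigma>)\<close> is a unit of \<open>S\<close>, and \<open>b_r(\<sigma>, \<tau>)\<close>
  has valuation exactly \<open>r(\<sigma>) + r(\<tau>) - r(\<sigma>\<tau>)\<close>. Rounding goes up
  because the ceiling is subadditive while the floor is superadditive. That \<open>f\<close> takes
  values in \<open>S\<close>, not merely in \<open>L\<close>, makes \<open>a\<close> nonnegative;
  hence the averages are nonnegative and subadditive, as membership of \<open>r\<close> in
  \<open>Sl(G)\<close> demands.\<close>

text \<open>Zorn's lemma on the ideals that contain \<open>a\<close> but not \<open>\<one>\<close>.
  It turns the hypothesis listing the maximal ideals of \<open>S\<close> into divisibility of every
  nonunit by the uniformizer.\<close>

lemma (in cring) nonunit_in_maximalideal: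
  assumes "a \<in> carrier R" and "a \<notin> Units R"
  obtains M where "maximalideal M R" and "a \<in> M"
proof -
  define \<A> where "\<A> = {I. ideal I R \<and> a \<in> I \<and> \<one> \<notin> I}"
  have "PIdl a \<in> \<A>"
    using ideal_eq_carrier_iff[OF assms(1)] assms cgenideal_self cgenideal_ideal
      ideal.one_imp_carrier[of "PIdl a" R]
    unfolding \<A>_def by blast
  have "\<exists>M\<in>\<A>. \<forall>J\<in>\<A>. M \<subseteq> J \<longrightarrow> J = M"
  proof (rule subset_Zorn)
    fix C assume C: "subset.chain \<A> C"
    show "\<exists>U\<in>\<A>. \<forall>J\<in>C. J \<subseteq> U"
    \<comment> \<open>The union of the empty chain is empty and hence no ideal, so
      \<open>PIdl a\<close> serves as its bound.\<close>
    proof (cases "C = {}")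
      case True
      with \<open>PIdl a \<in> \<A>\<close> show ?thesis by blast
    next
      case False
      have "subset.chain {I. ideal I R} C"
        using C unfolding \<A>_def pred_on.chain_def by auto
      then have "ideal (\<Union> C) R"
        using chain_Union_is_ideal[of C] False by simp
      then have "\<Union> C \<in> \<A>"
        using C False unfolding \<A>_def pred_on.chain_def by auto
      then show ?thesis by blast
    qed
  qed
  then obtain M where M: "M \<in> \<A>" "\<And>J. J \<in> \<A> \<Longrightarrow> M \<subseteq> J \<Longrightarrow> J = M" by blast
  have "maximalideal M R"
  proof (rule maximalidealI)
    show "ideal M R" using M(1) by (simp add: \<A>_def)
    show "carrier R \<noteq> M" using M(1) by (auto simp: \<A>_def)
    fix J assume J: "ideal J R" "M \<subseteq> J" "J \<subseteq> carrier R"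
    show "J = M \<or> J = carrier R"
      using M J ideal.one_imp_carrier[OF J(1)] unfolding \<A>_def by blast
  qed
  with M(1) show thesis using that by (simp add: \<A>_def)
qed

section \<open>Powers of principal ideals and divisibility\<close>

lemma (in cring) mem_cgenideal_iff:
  assumes "a \<in> carrier R"
  shows "x \<in> PIdl a \<longleftrightarrow> (\<exists>y \<in> carrier R. x = a \<otimes> y)"
  using m_comm[OF assms] unfolding cgenideal_def by auto

text \<open>\<open>adic_val\<close> is defined through powers in \<open>ideals_set\<close>; for a
  principal ideal, membership in them thereby becomes divisibility by powers of the
  generator.\<close>

lemma (in cring) cgenideal_pow:
  assumes "a \<in> carrier R"
  shows "PIdl a [^]\<^bsub>ideals_set R\<^esub> (n::nat) = PIdl (a [^] n)"
proof (induct n)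
  case 0
  show ?case
    using ideal_eq_carrier_iff[OF one_closed] by (simp add: ideals_set_def nat_pow_def)
next
  case (Suc n)
  have "(PIdl (a [^] n)) \<cdot> (PIdl a) = PIdl (a [^] n \<otimes> a)" (is "?L = ?R")
  proof
    show "?L \<subseteq> ?R"
    proof
      fix s assume "s \<in> ?L"
      then show "s \<in> ?R"
      proof (induct s rule: ideal_prod.induct)
        case (prod i j)
        then obtain y z where "y \<in> carrier R" "i = a [^] n \<otimes> y" "z \<in> carrier R" "j = a \<otimes> z"
          using assms mem_cgenideal_iff by auto
        then have "i \<otimes> j = (a [^] n \<otimes> a) \<otimes> (y \<otimes> z)" "y \<otimes> z \<in> carrier R"
          using assms nat_pow_closed[OF assms, of n] by (auto simp: m_ac)
        then show ?case using assms mem_cgenideal_iff by auto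
      next
        case (sum s1 s2)
        then show ?case
          using additive_subgroup.a_closed[OF ideal.axioms(1)[OF cgenideal_ideal]] assms by auto
      qed
    qed
    show "?R \<subseteq> ?L"
    proof
      fix s assume "s \<in> ?R"
      then obtain y where y: "y \<in> carrier R" "s = a [^] n \<otimes> (a \<otimes> y)"
        using assms mem_cgenideal_iff[of "a [^] n \<otimes> a"] by (auto simp: m_assoc)
      show "s \<in> ?L"
        unfolding y(2) using assms y(1) mem_cgenideal_iff[OF assms]
        by (intro ideal_prod.prod) (auto intro: cgenideal_self)
    qed
  qed
  with Suc show ?case by (simp add: ideals_set_def nat_pow_def)
qed

section \<open>The valuation attached to a uniformizer\<close>

lemma (in domain) nat_pow_nonzero:
  assumes "a \<in> carrier R" "a \<noteq> \<zero>"
  shows "a [^] (n::nat) \<noteq> \<zero>"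
  using assms integral_iff by (induct n) auto

text \<open>A discrete valuation ring in terms of elements. This form can be reached for both rings
  in play: for the base ring from factorization into irreducibles, for \<open>S\<close>, which is
  not given as a principal domain, from divisibility in the base ring.\<close>

locale uniformized_domain = domain +
  fixes t
  assumes t_closed [simp, intro]: "t \<in> carrier R"
    and t_nonzero: "t \<noteq> \<zero>"
    and t_nonunit: "t \<notin> Units R"
    and factor: "x \<in> carrier R \<Longrightarrow> x \<noteq> \<zero> \<Longrightarrow> \<exists>n::nat. \<exists>w \<in> Units R. x = t [^] n \<otimes> w"
begin

abbreviation v where "v \<equiv> adic_val R (PIdl t)"

lemma generator_nonzero:
  assumes "PIdl a = PIdl t" shows "a \<noteq> \<zero>"
proof
  assume "a = \<zero>"
  then have "t \<in> PIdl \<zero>" using assms cgenideal_self by auto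
  then show False using t_nonzero mem_cgenideal_iff[of \<zero> t] by auto
qed

text \<open>If \<open>m\<close> exceeded \<open>n\<close>, cancelling \<open>t [^] n\<close> would
  leave \<open>t\<close> dividing the unit \<open>w\<close>. Hence the exponents under
  \<open>GREATEST\<close> in \<open>adic_val\<close> are bounded and their maximum is
  \<open>n\<close>.\<close>

lemma t_pow_mult_unit_mem_iff:
  assumes "w \<in> Units R"
  shows "t [^] n \<otimes> w \<in> PIdl t [^]\<^bsub>ideals_set R\<^esub> m \<longleftrightarrow> m \<le> (n::nat)"
proof
  have w: "w \<in> carrier R" using assms by auto
  {
    assume "t [^] n \<otimes> w \<in> PIdl t [^]\<^bsub>ideals_set R\<^esub> m"
    then obtain y where y: "y \<in> carrier R" "t [^] n \<otimes> w = t [^] m \<otimes> y"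
      using mem_cgenideal_iff[of "t [^] m"] by (auto simp: cgenideal_pow)
    show "m \<le> n"
    proof (rule ccontr)
      assume "\<not> m \<le> n"
      then obtain k where "m = n + Suc k" using less_iff_Suc_add[of n m] by auto
      then have "t [^] m \<otimes> y = t [^] n \<otimes> (t \<otimes> (t [^] k \<otimes> y))"
        using y(1) nat_pow_mult[OF t_closed, of n "Suc k", symmetric] by (simp add: m_ac)
      with y have "w = t \<otimes> (t [^] k \<otimes> y)"
        using w m_lcancel[of "t [^] n" w "t \<otimes> (t [^] k \<otimes> y)"]
          nat_pow_nonzero[OF t_closed t_nonzero, of n] by simp
      then have "t \<in> Units R"
        using assms y(1) unit_factor[of t "t [^] k \<otimes> y"] by auto
      with t_nonunit show False by simp
    qed
  }
  assume "m \<le> n"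
  then have "t [^] n \<otimes> w = t [^] m \<otimes> (t [^] (n - m) \<otimes> w)"
    using w nat_pow_mult[OF t_closed, of m "n - m"] by (simp add: m_assoc[symmetric])
  then show "t [^] n \<otimes> w \<in> PIdl t [^]\<^bsub>ideals_set R\<^esub> m"
    using w mem_cgenideal_iff[of "t [^] m"] by (auto simp: cgenideal_pow)
qed

lemma v_t_pow_mult_unit:
  assumes "w \<in> Units R" shows "v (t [^] (n::nat) \<otimes> w) = n"
  unfolding adic_val_def t_pow_mult_unit_mem_iff[OF assms] by (rule Greatest_equality) auto

lemma v_unit: "w \<in> Units R \<Longrightarrow> v w = 0"
  using v_t_pow_mult_unit[of w 0] by auto

lemma v_t: "v t = 1"
  using v_t_pow_mult_unit[of \<one> 1] by simp

lemma v_mult: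
  assumes "x \<in> carrier R" "x \<noteq> \<zero>" "y \<in> carrier R" "y \<noteq> \<zero>"
  shows "v (x \<otimes> y) = v x + v y"
proof -
  obtain n m :: nat and w z where
    "x = t [^] n \<otimes> w" "w \<in> Units R" "y = t [^] m \<otimes> z" "z \<in> Units R"
    using factor assms by meson
  moreover from this have "x \<otimes> y = t [^] (n + m) \<otimes> (w \<otimes> z)" "w \<otimes> z \<in> Units R"
    using nat_pow_mult[OF t_closed, of n m, symmetric] Units_closed by (auto simp: m_ac)
  ultimately show ?thesis by (simp add: v_t_pow_mult_unit)
qed

lemma v_pow: "x \<in> carrier R \<Longrightarrow> x \<noteq> \<zero> \<Longrightarrow> v (x [^] (n::nat)) = n * v x"
  by (induct n) (auto simp: v_mult v_unit nat_pow_nonzero)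

text \<open>A ring homomorphism maps units to units, so one that fixes \<open>t\<close> keeps the
  exponent in the normal form of \<open>x\<close>.\<close>

lemma v_hom:
  assumes "h \<in> ring_hom R R" "h t = t" "x \<in> carrier R" "x \<noteq> \<zero>"
  shows "v (h x) = v x"
proof -
  interpret h: ring_hom_cring R R h
    using assms(1) by unfold_locales
  obtain n :: nat and w where x: "x = t [^] n \<otimes> w" "w \<in> Units R"
    using factor assms by meson
  have h_pow: "h (t [^] n) = t [^] n"
    using assms(2) by (induct n) auto
  have "h w \<in> Units R" using x(2)
    by (metis Units_closed Units_inv_closed Units_r_inv h.hom_closed h.hom_mult h.hom_one
        unit_factor Units_one_closed)
  moreover have "h x = t [^] n \<otimes> h w"
    using x assms(2) Units_closed[OF x(2)] by (simp add: h_pow)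
  ultimately show ?thesis using x by (simp add: v_t_pow_mult_unit)
qed

end

section \<open>Criteria for the existence of a uniformizer\<close>

text \<open>Take the least \<open>n\<close> for which \<open>t [^] n\<close> fails to divide
  \<open>x\<close>. It is positive, as \<open>t [^] 0\<close> divides everything, and the cofactor
  of the power just below is a unit: otherwise it would contain one more factor
  \<open>t\<close>.\<close>

lemma (in domain) uniformized_domainI:
  assumes "t \<in> carrier R" "t \<noteq> \<zero>" "t \<notin> Units R"
    and nonunit: "\<And>x. x \<in> carrier R \<Longrightarrow> x \<notin> Units R \<Longrightarrow> x \<in> PIdl t"
    and bounded: "\<And>x. x \<in> carrier R \<Longrightarrow> x \<noteq> \<zero> \<Longrightarrow> \<exists>n::nat. x \<notin> PIdl (t [^] n)"
  shows "uniformized_domain R t"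
proof unfold_locales
  fix x assume x: "x \<in> carrier R" "x \<noteq> \<zero>"
  have t_pow: "t [^] n \<in> carrier R" for n :: nat using assms(1) by simp
  define n where "n = (LEAST n::nat. x \<notin> PIdl (t [^] n))"
  have n: "x \<notin> PIdl (t [^] n)"
    unfolding n_def using bounded[OF x] by (rule LeastI_ex)
  have "n \<noteq> 0"
    using n x(1) mem_cgenideal_iff[OF one_closed] by (cases n) auto
  then obtain k where k: "n = Suc k" using not0_implies_Suc by auto
  then have "x \<in> PIdl (t [^] k)"
    using not_less_Least[of k "\<lambda>n. x \<notin> PIdl (t [^] n)"] unfolding n_def by auto
  then obtain w where w: "w \<in> carrier R" "x = t [^] k \<otimes> w"
    using mem_cgenideal_iff[OF t_pow] by auto
  have "w \<in> Units R"
  proof (rule ccontr)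
    assume "w \<notin> Units R"
    then obtain y where "y \<in> carrier R" "w = t \<otimes> y"
      using nonunit[OF w(1)] mem_cgenideal_iff[OF assms(1)] by auto
    then have "x = t [^] n \<otimes> y"
      using w assms(1) t_pow[of k] by (simp add: k m_assoc)
    with n \<open>y \<in> carrier R\<close> show False using mem_cgenideal_iff[OF t_pow] by auto
  qed
  with w show "\<exists>n::nat. \<exists>w \<in> Units R. x = t [^] n \<otimes> w" by blast
qed (use assms in auto)

text \<open>An irreducible element generates a maximal ideal, hence the only one, and is therefore
  associated to \<open>t\<close>. Every factorization into irreducibles thus collapses to a power of
  \<open>t\<close> times a unit.\<close>

lemma discrete_valuation_ring_uniformizer:
  assumes "discrete_valuation_ring A"
  obtains t where "uniformized_domain A t" and "maximalideal (PIdl\<^bsub>A\<^esub> t) A"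
proof -
  interpret principal_domain A using assms by (simp add: discrete_valuation_ring_def)
  obtain m where m: "maximalideal m A" and uniq: "\<And>m'. maximalideal m' A \<Longrightarrow> m' = m"
    using assms unfolding discrete_valuation_ring_def by blast
  obtain t where t: "t \<in> carrier A" "m = PIdl\<^bsub>A\<^esub> t"
    using exists_gen maximalideal.axioms(1)[OF m] by blast
  have "t \<noteq> \<zero>\<^bsub>A\<^esub>"
  proof
    assume "t = \<zero>\<^bsub>A\<^esub>"
    then have "PIdl\<^bsub>A\<^esub> t = {\<zero>\<^bsub>A\<^esub>}" using mem_cgenideal_iff[OF t(1)] by auto
    then show False
      using m t(2) zeromaximalideal_eq_field assms by (simp add: discrete_valuation_ring_def)
  qed
  have "t \<notin> Units A"
    using ideal_eq_carrier_iff[OF t(1)] maximalideal.I_notcarr[OF m] t(2) by auto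
  have irr: "\<exists>w \<in> Units A. x = t \<otimes>\<^bsub>A\<^esub> w"
    if "x \<in> carrier A - {\<zero>\<^bsub>A\<^esub>}" "irreducible (mult_of A) x" for x
  proof -
    have "ring_irreducible\<^bsub>A\<^esub> x"
      using that irreducible_mult_imp_irreducible by (simp add: ring_irreducible_def)
    then have "PIdl\<^bsub>A\<^esub> x = PIdl\<^bsub>A\<^esub> t"
      using irreducible_imp_maximalideal uniq that t(2) by auto
    then show ?thesis
      using that t associated_iff_same_ideal[of x t] ring_associated_iff[of x t]
      by (metis DiffD1 Units_closed m_comm)
  qed
  have "\<exists>n::nat. \<exists>w \<in> Units A. foldr (\<otimes>\<^bsub>A\<^esub>) fs \<one>\<^bsub>A\<^esub> = t [^]\<^bsub>A\<^esub> n \<otimes>\<^bsub>A\<^esub> w"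
    if "set fs \<subseteq> carrier (mult_of A)" "\<forall>x \<in> set fs. irreducible (mult_of A) x" for fs
    using that
  proof (induct fs)
    case Nil
    have "foldr (\<otimes>\<^bsub>A\<^esub>) [] \<one>\<^bsub>A\<^esub> = t [^]\<^bsub>A\<^esub> (0::nat) \<otimes>\<^bsub>A\<^esub> \<one>\<^bsub>A\<^esub>" by simp
    then show ?case by blast
  next
    case (Cons x fs)
    obtain w where w: "w \<in> Units A" "x = t \<otimes>\<^bsub>A\<^esub> w"
      using irr[of x] Cons(2,3) by auto
    obtain n :: nat and z where z: "z \<in> Units A"
      "foldr (\<otimes>\<^bsub>A\<^esub>) fs \<one>\<^bsub>A\<^esub> = t [^]\<^bsub>A\<^esub> n \<otimes>\<^bsub>A\<^esub> z"
      using Cons by auto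
    have "foldr (\<otimes>\<^bsub>A\<^esub>) (x # fs) \<one>\<^bsub>A\<^esub> = t [^]\<^bsub>A\<^esub> Suc n \<otimes>\<^bsub>A\<^esub> (w \<otimes>\<^bsub>A\<^esub> z)"
      using w z t(1) Units_closed nat_pow_closed[OF t(1), of n] by (simp add: m_ac)
    then show ?case using w(1) z(1) by blast
  qed
  note prod = this
  have "\<exists>n::nat. \<exists>w \<in> Units A. x = t [^]\<^bsub>A\<^esub> n \<otimes>\<^bsub>A\<^esub> w"
    if x: "x \<in> carrier A" "x \<noteq> \<zero>\<^bsub>A\<^esub>" for x
  proof (cases "x \<in> Units A")
    case True
    then have "x = t [^]\<^bsub>A\<^esub> (0::nat) \<otimes>\<^bsub>A\<^esub> x" using x by simp
    with True show ?thesis by blast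
  next
    case False
    then obtain fs where fs: "set fs \<subseteq> carrier (mult_of A)" "wfactors (mult_of A) fs x"
      using factorization_property[of x] x by blast
    then obtain n :: nat and w where w: "w \<in> Units A"
      "foldr (\<otimes>\<^bsub>A\<^esub>) fs \<one>\<^bsub>A\<^esub> = t [^]\<^bsub>A\<^esub> n \<otimes>\<^bsub>A\<^esub> w"
      using prod[OF fs(1)] fs(2) by (auto simp: wfactors_def)
    have car: "w \<in> carrier A" "t [^]\<^bsub>A\<^esub> n \<in> carrier A"
      using w(1) t(1) by auto
    \<comment> \<open>\<open>wfactors\<close> recovers \<open>x\<close> only up to association,
      which costs one further unit \<open>z\<close>.\<close>
    have "t [^]\<^bsub>A\<^esub> n \<otimes>\<^bsub>A\<^esub> w \<sim>\<^bsub>A\<^esub> x"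
      using fs(2) x(1) w(2) car assoc_iff_assoc_mult[of "t [^]\<^bsub>A\<^esub> n \<otimes>\<^bsub>A\<^esub> w" x]
      by (simp add: wfactors_def)
    then obtain z where z: "z \<in> Units A" "x = z \<otimes>\<^bsub>A\<^esub> (t [^]\<^bsub>A\<^esub> n \<otimes>\<^bsub>A\<^esub> w)"
      using ring_associated_iff[of x "t [^]\<^bsub>A\<^esub> n \<otimes>\<^bsub>A\<^esub> w"] associated_sym x(1) car by auto
    then have "x = t [^]\<^bsub>A\<^esub> n \<otimes>\<^bsub>A\<^esub> (z \<otimes>\<^bsub>A\<^esub> w)"
      using car Units_closed[OF z(1)] by (simp add: m_ac)
    with z(1) w(1) show ?thesis by blast
  qed
  then have "uniformized_domain A t"
    using t \<open>t \<noteq> \<zero>\<^bsub>A\<^esub>\<close> \<open>t \<notin> Units A\<close> by unfold_locales auto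
  with that m t(2) show thesis by blast
qed


section \<open>Integral closure of a discrete valuation ring\<close>

text \<open>Coefficient lists start with the leading coefficient, so induction from the right strips
  constant terms. A zero constant term is removed by cancelling \<open>x\<close>; a nonzero one is,
  up to sign, \<open>x\<close> times the value of the remaining polynomial. So an integral
  \<open>x \<noteq> \<zero>\<close> divides a nonzero element of the base ring, with a cofactor that
  is again polynomial in \<open>x\<close>.\<close>

lemma (in domain) root_divides_constant_term:
  assumes "subring H R" "set p \<subseteq> H" "p \<noteq> []" "hd p \<noteq> \<zero>"
    and "x \<in> carrier R" "x \<noteq> \<zero>" "eval p x = \<zero>"
  shows "\<exists>a \<in> H - {\<zero>}. \<exists>q. set q \<subseteq> H \<and> a = x \<otimes> eval q x"
  using assms(2-4,7)
proof (induct p rule: rev_induct)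
  case Nil
  then show ?case by simp
next
  case (snoc b p)
  have H: "H \<subseteq> carrier R" using subringE(1)[OF assms(1)] .
  then have car: "set p \<subseteq> carrier R" "b \<in> carrier R" "eval p x \<in> carrier R"
    using snoc(2) assms(5) eval_in_carrier by auto
  have sum: "eval p x \<otimes> x \<oplus> b = \<zero>"
    using eval_append_aux[OF car(1,2) assms(5)] snoc(5) by simp
  show ?case
  proof (cases "b = \<zero>")
    case True
    then have "eval p x = \<zero>"
      using sum car assms(5,6) integral by auto
    moreover have "p \<noteq> []" "hd p \<noteq> \<zero>"
      using snoc(4) True by (auto simp: hd_append split: if_splits)
    ultimately show ?thesis using snoc(1,2) by auto
  next
    case False
    have "\<ominus> b = x \<otimes> eval p x"
      using sum_zero_eq_neg[of "eval p x \<otimes> x" b] sum car assms(5) m_comm minus_equality by auto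
    moreover have "\<ominus> b \<in> H - {\<zero>}"
      using False snoc(2) subringE(5)[OF assms(1)] car(2) by auto
    ultimately show ?thesis using snoc(2) by auto
  qed
qed

lemma subset_integral_closure_in:
  assumes "ring L" "\<one>\<^bsub>L\<^esub> \<noteq> \<zero>\<^bsub>L\<^esub>" "subring A L"
  shows "A \<subseteq> integral_closure_in L A"
proof
  interpret ring L by fact
  fix a assume a: "a \<in> A"
  then have "a \<in> carrier L" using subringE(1)[OF assms(3)] by auto
  then have "ring.eval L [\<one>\<^bsub>L\<^esub>, \<ominus>\<^bsub>L\<^esub> a] a = \<zero>\<^bsub>L\<^esub>"
    by (simp add: r_neg)
  moreover have "[\<one>\<^bsub>L\<^esub>, \<ominus>\<^bsub>L\<^esub> a] \<in> carrier (A [X]\<^bsub>L\<^esub>)"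
    using subringE(3,5)[OF assms(3)] a assms(2)
    by (simp add: univ_poly_carrier[symmetric] polynomial_def)
  ultimately show "a \<in> integral_closure_in L A"
    unfolding integral_closure_in_def using \<open>a \<in> carrier L\<close>
    by (intro CollectI conjI bexI[of _ "[\<one>\<^bsub>L\<^esub>, \<ominus>\<^bsub>L\<^esub> a]"]) auto
qed

text \<open>A map fixing the coefficients of a monic polynomial sends its roots to roots. This lets
  the Galois group act on \<open>S\<close>.\<close>

lemma integral_closure_in_hom_closed:
  assumes "ring L" "subring A L" "h \<in> ring_hom L L" "\<And>a. a \<in> A \<Longrightarrow> h a = a"
    and "x \<in> integral_closure_in L A"
  shows "h x \<in> integral_closure_in L A"
proof -
  interpret h: ring_hom_ring L L h
    using assms(1,3) by (simp add: ring_hom_ring.intro ring_hom_ring_axioms_def)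
  obtain p where x: "x \<in> carrier L" and p: "p \<in> carrier (A [X]\<^bsub>L\<^esub>)" "p \<noteq> []"
    "lead_coeff p = \<one>\<^bsub>L\<^esub>" "ring.eval L p x = \<zero>\<^bsub>L\<^esub>"
    using assms(5) by (auto simp: integral_closure_in_def)
  have "set p \<subseteq> A"
    using p(1) by (auto simp: univ_poly_carrier[symmetric] polynomial_def)
  then have "map h p = p"
    using assms(4) by (intro map_idI) auto
  then have "ring.eval L p (h x) = \<zero>\<^bsub>L\<^esub>"
    using h.eval_hom[OF assms(2) x p(1)] p(4) by simp
  then show ?thesis
    using p x by (auto simp: integral_closure_in_def)
qed

text \<open>Ramification index one says that the maximal ideal of \<open>A\<close> generates that of
  \<open>S\<close>, so a uniformizer of \<open>A\<close> serves for \<open>S\<close> too. Nonunits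
  of \<open>S\<close> lie in its only maximal ideal, and divisibility of \<open>x\<close> by powers
  of \<open>t\<close> is bounded by means of a nonzero multiple of \<open>x\<close> in
  \<open>A\<close>.\<close>

lemma integral_closure_uniformizer:
  assumes "field L" "subring A L" "discrete_valuation_ring (L\<lparr>carrier := A\<rparr>)"
    and S: "S = integral_closure_in L A"
    and max: "{M. maximalideal M (L\<lparr>carrier := S\<rparr>)} = {PIdl\<^bsub>L\<lparr>carrier := S\<rparr>\<^esub> \<pi>}"
    and "unramified_extension (L\<lparr>carrier := A\<rparr>) (L\<lparr>carrier := S\<rparr>)"
  obtains t where "subring S L" "t \<in> A" "uniformized_domain (L\<lparr>carrier := S\<rparr>) t"
    "PIdl\<^bsub>L\<lparr>carrier := S\<rparr>\<^esub> \<pi> = PIdl\<^bsub>L\<lparr>carrier := S\<rparr>\<^esub> t"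
proof -
  interpret L: field L by fact
  let ?A = "L\<lparr>carrier := A\<rparr>" and ?B = "L\<lparr>carrier := S\<rparr>"
  have max_\<pi>: "maximalideal (PIdl\<^bsub>?B\<^esub> \<pi>) ?B" using max by auto
  have S_carrier: "S \<subseteq> carrier L" by (auto simp: S integral_closure_in_def)
  \<comment> \<open>That the integral elements form a ring is read off from the existence of a
    maximal ideal: \<open>ideal\<close> includes that the ambient structure is a ring.\<close>
  have "subring S L"
    using L.ring_incl_imp_subring[OF S_carrier]
      ideal.axioms(2)[OF maximalideal.axioms(1)[OF max_\<pi>]] .
  interpret B: domain ?B using L.subring_is_domain[OF \<open>subring S L\<close>] .
  have "A \<subseteq> S"
    unfolding S using subset_integral_closure_in[OF L.ring_axioms _ assms(2)] by simp
  obtain t where "uniformized_domain ?A t" and max_t: "maximalideal (PIdl\<^bsub>?A\<^esub> t) ?A"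
    using discrete_valuation_ring_uniformizer[OF assms(3)] .
  then interpret A: uniformized_domain ?A t by simp
  have "t \<in> A" using A.t_closed by simp
  with \<open>A \<subseteq> S\<close> have "t \<in> S" by auto
  have pow: "x [^]\<^bsub>?B\<^esub> n = x [^]\<^bsub>L\<^esub> n" "x [^]\<^bsub>?A\<^esub> n = x [^]\<^bsub>L\<^esub> n" for x and n :: nat
    by (simp_all add: nat_pow_def)
  have "PIdl\<^bsub>?B\<^esub> \<pi> = Idl\<^bsub>?B\<^esub> (PIdl\<^bsub>?A\<^esub> t)"
    using assms(6) max_t max_\<pi> unfolding unramified_extension_def by blast
  also have "\<dots> = PIdl\<^bsub>?B\<^esub> t"
  proof
    have "PIdl\<^bsub>?A\<^esub> t \<subseteq> PIdl\<^bsub>?B\<^esub> t"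
      using \<open>A \<subseteq> S\<close> by (auto simp: cgenideal_def)
    then show "Idl\<^bsub>?B\<^esub> (PIdl\<^bsub>?A\<^esub> t) \<subseteq> PIdl\<^bsub>?B\<^esub> t"
      using B.genideal_minimal B.cgenideal_ideal \<open>t \<in> S\<close> by simp
    have sub: "PIdl\<^bsub>?A\<^esub> t \<subseteq> carrier ?B"
      using ideal.Icarr[OF A.cgenideal_ideal[OF A.t_closed]] \<open>A \<subseteq> S\<close> by auto
    then have "t \<in> Idl\<^bsub>?B\<^esub> (PIdl\<^bsub>?A\<^esub> t)"
      using B.genideal_self[OF sub] A.cgenideal_self[OF A.t_closed] by blast
    then show "PIdl\<^bsub>?B\<^esub> t \<subseteq> Idl\<^bsub>?B\<^esub> (PIdl\<^bsub>?A\<^esub> t)"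
      using B.cgenideal_minimal[OF B.genideal_ideal[OF sub]] by simp
  qed
  finally have eq: "PIdl\<^bsub>?B\<^esub> \<pi> = PIdl\<^bsub>?B\<^esub> t" .
  have nonunit: "t \<notin> Units ?B"
    using B.ideal_eq_carrier_iff[of t] maximalideal.I_notcarr[OF max_\<pi>] eq \<open>t \<in> S\<close> by auto
  have "uniformized_domain ?B t"
  proof (rule B.uniformized_domainI)
    show "t \<in> carrier ?B" "t \<noteq> \<zero>\<^bsub>?B\<^esub>" "t \<notin> Units ?B"
      using \<open>t \<in> S\<close> A.t_nonzero nonunit by auto
  next
    fix x assume "x \<in> carrier ?B" "x \<notin> Units ?B"
    then show "x \<in> PIdl\<^bsub>?B\<^esub> t"
      using B.nonunit_in_maximalideal[of x] max eq by (metis mem_Collect_eq singletonD)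
  next
    fix x assume x: "x \<in> carrier ?B" "x \<noteq> \<zero>\<^bsub>?B\<^esub>"
    then obtain p where p: "p \<in> carrier (A [X]\<^bsub>L\<^esub>)" "p \<noteq> []"
      "lead_coeff p = \<one>\<^bsub>L\<^esub>" "L.eval p x = \<zero>\<^bsub>L\<^esub>"
      by (auto simp: S integral_closure_in_def)
    then obtain a q where a: "a \<in> A - {\<zero>\<^bsub>L\<^esub>}" "set q \<subseteq> A" "a = x \<otimes>\<^bsub>L\<^esub> L.eval q x"
      using L.root_divides_constant_term[OF assms(2), of p x] x S_carrier
      by (auto simp: univ_poly_carrier[symmetric] polynomial_def)
    define y where "y = L.eval q x"
    have "y \<in> S"
      using B.eval_in_carrier[of q x] a(2) x(1) \<open>A \<subseteq> S\<close> L.eval_consistent[OF \<open>subring S L\<close>]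
      by (auto simp: y_def)
    obtain k :: nat and w where w: "w \<in> Units ?A" "a = t [^]\<^bsub>L\<^esub> k \<otimes>\<^bsub>L\<^esub> w"
      using A.factor[of a] a(1) by (auto simp: pow)
    have "w \<in> Units ?B"
      using w(1) \<open>A \<subseteq> S\<close> by (auto simp: Units_def)
    \<comment> \<open>The exponent comes from \<open>x \<otimes> y = a = t [^] k \<otimes> w\<close>
      with \<open>w\<close> a unit: one more factor \<open>t\<close> in \<open>x\<close> would make
      \<open>t\<close> divide \<open>w\<close>.\<close>
    have "x \<notin> PIdl\<^bsub>?B\<^esub> (t [^]\<^bsub>?B\<^esub> Suc k)"
    proof
      have t_pow: "t [^]\<^bsub>L\<^esub> n \<in> S" for n :: nat
        using B.nat_pow_closed[of t n] \<open>t \<in> S\<close> by (simp add: pow)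
      assume "x \<in> PIdl\<^bsub>?B\<^esub> (t [^]\<^bsub>?B\<^esub> Suc k)"
      then obtain z where z: "z \<in> S" "x = t [^]\<^bsub>L\<^esub> Suc k \<otimes>\<^bsub>L\<^esub> z"
        using B.mem_cgenideal_iff[of "t [^]\<^bsub>L\<^esub> Suc k" x] t_pow[of "Suc k"]
        by (auto simp: pow)
      have car: "t \<in> carrier L" "t [^]\<^bsub>L\<^esub> k \<in> carrier L" "z \<in> carrier L" "y \<in> carrier L" "w \<in> carrier L"
        using z(1) \<open>y \<in> S\<close> \<open>w \<in> Units ?B\<close> S_carrier \<open>t \<in> S\<close> by (auto simp: Units_def)
      have "t [^]\<^bsub>L\<^esub> k \<otimes>\<^bsub>L\<^esub> w = x \<otimes>\<^bsub>L\<^esub> y"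
        using w(2) a(3) by (simp add: y_def)
      also have "\<dots> = t [^]\<^bsub>L\<^esub> k \<otimes>\<^bsub>L\<^esub> (t \<otimes>\<^bsub>L\<^esub> (z \<otimes>\<^bsub>L\<^esub> y))"
        unfolding z(2) using car by (simp add: L.m_assoc)
      finally have "t [^]\<^bsub>L\<^esub> k \<otimes>\<^bsub>L\<^esub> w = t [^]\<^bsub>L\<^esub> k \<otimes>\<^bsub>L\<^esub> (t \<otimes>\<^bsub>L\<^esub> (z \<otimes>\<^bsub>L\<^esub> y))" .
      then have "w = t \<otimes>\<^bsub>L\<^esub> (z \<otimes>\<^bsub>L\<^esub> y)"
        using car L.m_lcancel L.nat_pow_nonzero[OF car(1)] A.t_nonzero by simp
      then have "t \<in> Units ?B"
        using B.unit_factor[of t "z \<otimes>\<^bsub>L\<^esub> y"] \<open>w \<in> Units ?B\<close> \<open>t \<in> S\<close> z(1) \<open>y \<in> S\<close>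
          B.m_closed by simp
      with nonunit show False by simp
    qed
    then show "\<exists>n::nat. x \<notin> PIdl\<^bsub>?B\<^esub> (t [^]\<^bsub>?B\<^esub> n)" by blast
  qed
  with that \<open>subring S L\<close> \<open>t \<in> A\<close> eq show thesis by blast
qed


section \<open>The Galois group\<close>

lemma galois_group_carrierD:
  assumes "\<sigma> \<in> carrier (galois_group L K)"
  shows "\<sigma> \<in> ring_hom L L" "\<sigma> \<in> Bij (carrier L)" "\<And>k. k \<in> K \<Longrightarrow> \<sigma> k = k"
  using assms by (auto simp: galois_group_def ring_iso_def)

lemma galois_group_mult:
  assumes "\<sigma> \<in> carrier (galois_group L K)" "\<tau> \<in> carrier (galois_group L K)"
  shows "\<sigma> \<otimes>\<^bsub>galois_group L K\<^esub> \<tau> = compose (carrier L) \<sigma> \<tau>"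
  using galois_group_carrierD(2)[OF assms(1)] galois_group_carrierD(2)[OF assms(2)]
  by (simp add: galois_group_def BijGroup_def)

lemma galois_group_one: "\<one>\<^bsub>galois_group L K\<^esub> = (\<lambda>x \<in> carrier L. x)"
  by (simp add: galois_group_def BijGroup_def)

text \<open>A subgroup of \<open>BijGroup\<close>. Its members are extensional, so the inverse has
  to be restricted to \<open>carrier L\<close>, and \<open>K \<subseteq> carrier L\<close> ensures
  that the restricted identity and inverses still fix \<open>K\<close>.\<close>

lemma group_galois_group:
  assumes "ring L" "K \<subseteq> carrier L"
  shows "group (galois_group L K)"
proof -
  interpret L: ring L by fact
  let ?H = "{\<sigma> \<in> ring_iso L L \<inter> Bij (carrier L). \<forall>k \<in> K. \<sigma> k = k}"
  have Bij_iso: "\<sigma> \<in> ring_iso L L" if "\<sigma> \<in> ring_hom L L" "\<sigma> \<in> Bij (carrier L)" for \<sigma>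
    using that by (simp add: ring_iso_def Bij_def)
  have "subgroup ?H (BijGroup (carrier L))"
  proof (rule group.subgroupI[OF group_BijGroup])
    show "?H \<subseteq> carrier (BijGroup (carrier L))" by (auto simp: BijGroup_def)
    have "(\<lambda>x \<in> carrier L. x) \<in> ring_hom L L"
      by (rule ring_hom_memI) auto
    then have "(\<lambda>x \<in> carrier L. x) \<in> ?H"
      using id_Bij Bij_iso assms(2) by auto
    then show "?H \<noteq> {}" by blast
  next
    fix \<sigma> assume \<sigma>: "\<sigma> \<in> ?H"
    let ?i = "\<lambda>x \<in> carrier L. inv_into (carrier L) \<sigma> x"
    have B: "\<sigma> \<in> Bij (carrier L)" and hom: "\<sigma> \<in> ring_hom L L"
      using \<sigma> by (auto simp: ring_iso_def)
    have inj: "inj_on \<sigma> (carrier L)" using B by (simp add: Bij_def bij_betw_def)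
    have inv: "inv_into (carrier L) \<sigma> x \<in> carrier L" if "x \<in> carrier L" for x
      using Bij_inv_into_mem[OF B that] .
    have fix_inv: "inv_into (carrier L) \<sigma> k = k" if "k \<in> carrier L" "\<sigma> k = k" for k
      using inv_into_f_f[OF inj that(1)] that(2) by simp
    have "?i \<in> ring_hom L L"
    proof (rule ring_hom_memI)
      show "?i \<one>\<^bsub>L\<^esub> = \<one>\<^bsub>L\<^esub>"
        using fix_inv ring_hom_one[OF hom] by simp
    next
      fix x y assume xy: "x \<in> carrier L" "y \<in> carrier L"
      show "?i x \<in> carrier L" using inv xy by simp
      show "?i (x \<otimes>\<^bsub>L\<^esub> y) = ?i x \<otimes>\<^bsub>L\<^esub> ?i y"
        using Bij_inv_into_lemma[of "carrier L" \<sigma> "(\<otimes>\<^bsub>L\<^esub>)" x y] ring_hom_mult[OF hom] B xy by simp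
      show "?i (x \<oplus>\<^bsub>L\<^esub> y) = ?i x \<oplus>\<^bsub>L\<^esub> ?i y"
        using Bij_inv_into_lemma[of "carrier L" \<sigma> "(\<oplus>\<^bsub>L\<^esub>)" x y] ring_hom_add[OF hom] B xy by simp
    qed
    then have "?i \<in> ?H"
      using restrict_inv_into_Bij[OF B] Bij_iso fix_inv \<sigma> assms(2) by auto
    then show "inv\<^bsub>BijGroup (carrier L)\<^esub> \<sigma> \<in> ?H"
      using inv_BijGroup[OF B] by simp
  next
    fix \<sigma> \<tau> assume \<sigma>: "\<sigma> \<in> ?H" and \<tau>: "\<tau> \<in> ?H"
    have hom: "\<sigma> \<in> ring_hom L L" "\<tau> \<in> ring_hom L L"
      using \<sigma> \<tau> by (auto simp: ring_iso_def)
    have "compose (carrier L) \<sigma> \<tau> \<in> ring_hom L L"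
      using hom by (intro ring_hom_memI) (auto simp: compose_def ring_hom_closed ring_hom_mult
          ring_hom_add ring_hom_one)
    then have "compose (carrier L) \<sigma> \<tau> \<in> ?H"
      using compose_Bij \<sigma> \<tau> Bij_iso assms(2) by (auto simp: compose_eq subset_iff)
    then show "\<sigma> \<otimes>\<^bsub>BijGroup (carrier L)\<^esub> \<tau> \<in> ?H"
      using \<sigma> \<tau> by (simp add: BijGroup_def)
  qed
  then show ?thesis
    using subgroup.subgroup_is_group[OF _ group_BijGroup] unfolding galois_group_def by blast
qed

lemma (in ring) ring_hom_eq_on_Span:
  assumes "h \<in> ring_hom R R" "h' \<in> ring_hom R R" "subfield K R" "set Us \<subseteq> carrier R"
    and "\<And>k. k \<in> K \<Longrightarrow> h k = k" "\<And>k. k \<in> K \<Longrightarrow> h' k = k"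
    and "\<And>x. x \<in> set Us \<Longrightarrow> h x = h' x" and "x \<in> Span K Us"
  shows "h x = h' x"
proof -
  \<comment> \<open>Quantified over \<open>Us\<close> afresh, because the induction over
    \<open>combine\<close> shortens both lists together.\<close>
  have hom_combine: "set Ks \<subseteq> K \<Longrightarrow> h (combine Ks Us) = h' (combine Ks Us)"
    if "set Us \<subseteq> carrier R" "\<And>x. x \<in> set Us \<Longrightarrow> h x = h' x" for Ks Us
    using that
  proof (induct Ks Us rule: combine.induct)
    case (1 k Ks u Us)
    then have "combine Ks Us \<in> carrier R" "k \<in> carrier R" "u \<in> carrier R"
      using combine_in_carrier subfieldE(3)[OF assms(3)] by auto
    with 1 show ?case
      using assms(1,2,5,6) by (simp add: ring_hom_add ring_hom_mult)
  qed (use ring_hom_zero[OF assms(1) ring_axioms ring_axioms]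
      ring_hom_zero[OF assms(2) ring_axioms ring_axioms] in auto)
  then show ?thesis
    using Span_eq_combine_set[OF assms(3,4)] assms(4,7,8) by auto
qed

text \<open>An automorphism is determined by the images of a finite spanning list, and each image is
  a root of a polynomial over \<open>K\<close> that vanishes at the original element. Finiteness is
  what permits averaging over the group.\<close>

lemma finite_galois_group:
  assumes "field L" "subfield K L" "ring.finite_galois_over L K"
  shows "finite (carrier (galois_group L K))"
proof -
  interpret L: field L by fact
  note gal = assms(3)[unfolded L.finite_galois_over_def L.separable_over_def]
  obtain Us where Us: "set Us \<subseteq> carrier L" "L.Span K Us = carrier L"
    using gal L.exists_base[OF assms(2)] by (meson L.finite_dimensionE')
  define conj where "conj x = (\<lambda>\<sigma>. \<sigma> x) ` carrier (galois_group L K)" for x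
  have "finite (conj x)" if x: "x \<in> carrier L" for x
  proof -
    obtain p where p: "p \<in> carrier (K[X]\<^bsub>L\<^esub>)" "p \<noteq> []" "L.eval p x = \<zero>\<^bsub>L\<^esub>"
      using L.algebraicE[OF subfieldE(1)[OF assms(2)] x] gal x by blast
    then have "p \<in> carrier (poly_ring L)"
      using L.carrier_polynomial_shell[OF subfieldE(1)[OF assms(2)]] by simp
    have "conj x \<subseteq> {y. L.is_root p y}"
    proof
      fix y assume "y \<in> conj x"
      then obtain \<sigma> where \<sigma>: "\<sigma> \<in> carrier (galois_group L K)" "y = \<sigma> x"
        by (auto simp: conj_def)
      interpret \<sigma>: ring_hom_ring L L \<sigma>
        using galois_group_carrierD(1)[OF \<sigma>(1)] L.ring_axioms
        by (simp add: ring_hom_ring.intro ring_hom_ring_axioms_def)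
      have "set p \<subseteq> K"
        using p(1) by (auto simp: univ_poly_carrier[symmetric] polynomial_def)
      then have "map \<sigma> p = p"
        using galois_group_carrierD(3)[OF \<sigma>(1)] by (intro map_idI) auto
      then have "L.eval p y = \<zero>\<^bsub>L\<^esub>"
        using \<sigma>.eval_hom[OF subfieldE(1)[OF assms(2)] x p(1)] p(3) \<sigma>(2) by simp
      then show "y \<in> {y. L.is_root p y}"
        using p(2) x \<sigma>(2) by (simp add: L.is_root_def)
    qed
    then show ?thesis
      using L.finite_number_of_roots[OF \<open>p \<in> carrier (poly_ring L)\<close>] finite_subset by blast
  qed
  then have "finite (\<Union>x \<in> set Us. conj x)" using Us(1) by auto
  then have "finite {ys. set ys \<subseteq> (\<Union>x \<in> set Us. conj x) \<and> length ys = length Us}"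
    by (rule finite_lists_length_eq)
  moreover have "(\<lambda>\<sigma>. map \<sigma> Us) ` carrier (galois_group L K)
      \<subseteq> {ys. set ys \<subseteq> (\<Union>x \<in> set Us. conj x) \<and> length ys = length Us}"
    by (force simp: conj_def)
  moreover have "inj_on (\<lambda>\<sigma>. map \<sigma> Us) (carrier (galois_group L K))"
  proof (rule inj_onI)
    fix \<sigma> \<tau> assume \<sigma>: "\<sigma> \<in> carrier (galois_group L K)" and \<tau>: "\<tau> \<in> carrier (galois_group L K)"
      and "map \<sigma> Us = map \<tau> Us"
    then have "\<And>x. x \<in> set Us \<Longrightarrow> \<sigma> x = \<tau> x" by simp
    note eq = this
    have "\<sigma> x = \<tau> x" if "x \<in> carrier L" for x
      by (rule L.ring_hom_eq_on_Span[OF galois_group_carrierD(1)[OF \<sigma>]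
          galois_group_carrierD(1)[OF \<tau>] assms(2) Us(1) galois_group_carrierD(3)[OF \<sigma>]
          galois_group_carrierD(3)[OF \<tau>]]) (use eq Us(2) that in simp_all)
    then show "\<sigma> = \<tau>"
      using galois_group_carrierD(2)[OF \<sigma>] galois_group_carrierD(2)[OF \<tau>] Bij_imp_extensional
      by (blast intro: extensionalityI)
  qed
  ultimately show ?thesis
    using finite_imageD finite_subset by blast
qed

section \<open>Cocycles\<close>

text \<open>Because \<open>c \<one> = 0\<close>, the averages at \<open>\<sigma>\<close> and
  \<open>inv \<sigma>\<close> add up to the integer \<open>a \<sigma> (inv \<sigma>)\<close>. Each
  ceiling adds at least 0 and less than 1, so the total excess is an integer below 2.\<close>

lemma (in group) nat_cocycle_Sl:
  fixes a :: "'a \<Rightarrow> 'a \<Rightarrow> nat"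
  assumes "finite (carrier G)"
    and cocycle: "\<And>\<sigma> \<tau> \<rho>. \<sigma> \<in> carrier G \<Longrightarrow> \<tau> \<in> carrier G \<Longrightarrow> \<rho> \<in> carrier G \<Longrightarrow>
      a \<sigma> \<tau> + a (\<sigma> \<otimes> \<tau>) \<rho> = a \<tau> \<rho> + a \<sigma> (\<tau> \<otimes> \<rho>)"
    and one: "\<And>\<rho>. \<rho> \<in> carrier G \<Longrightarrow> a \<one> \<rho> = 0"
  obtains r where "r \<in> Sl G"
    and "\<And>\<sigma>. \<sigma> \<in> carrier G \<Longrightarrow> a \<sigma> (inv \<sigma>) \<le> r \<sigma> + r (inv \<sigma>)"
    and "\<And>\<sigma>. \<sigma> \<in> carrier G \<Longrightarrow> r \<sigma> + r (inv \<sigma>) \<le> Suc (a \<sigma> (inv \<sigma>))"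
proof -
  define A where "A \<sigma> = (\<Sum>\<rho> \<in> carrier G. a \<sigma> \<rho>)" for \<sigma>
  define c where "c \<sigma> = real (A \<sigma>) / real (order G)" for \<sigma>
  define r where "r \<sigma> = nat \<lceil>c \<sigma>\<rceil>" for \<sigma>
  have pos: "order G > 0" using assms(1) order_gt_0_iff_finite by simp
  have int_r: "int (r \<sigma>) = \<lceil>c \<sigma>\<rceil>" for \<sigma>
  proof -
    have "0 \<le> c \<sigma>" by (simp add: c_def)
    then show ?thesis unfolding r_def by linarith
  qed
  have sum: "c \<sigma> + c \<tau> = real (a \<sigma> \<tau>) + c (\<sigma> \<otimes> \<tau>)"
    if "\<sigma> \<in> carrier G" "\<tau> \<in> carrier G" for \<sigma> \<tau>
  proof -
    \<comment> \<open>Left translation by \<open>\<tau>\<close> permutes the group, so summing the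
      cocycle identity over \<open>\<rho>\<close> turns its last term into
      \<open>A \<sigma>\<close>.\<close>
    have "(\<Sum>\<rho> \<in> carrier G. a \<sigma> (\<tau> \<otimes> \<rho>)) = A \<sigma>"
      unfolding A_def using that
      by (intro sum.reindex_bij_witness[of _ "\<lambda>\<rho>. inv \<tau> \<otimes> \<rho>" "\<lambda>\<rho>. \<tau> \<otimes> \<rho>"])
        (auto simp: m_assoc[symmetric])
    then have "order G * a \<sigma> \<tau> + A (\<sigma> \<otimes> \<tau>) = A \<tau> + A \<sigma>"
      using sum.cong[OF refl cocycle[OF that], of "carrier G"]
      by (simp add: sum.distrib A_def order_def)
    then have "real (order G) * real (a \<sigma> \<tau>) + real (A (\<sigma> \<otimes> \<tau>)) = real (A \<tau>) + real (A \<sigma>)"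
      by (metis of_nat_add of_nat_mult)
    then show ?thesis using pos by (simp add: c_def field_simps)
  qed
  have "c \<one> = 0" by (simp add: c_def A_def one)
  show thesis
  proof
    have "r (\<sigma> \<otimes> \<tau>) \<le> r \<sigma> + r \<tau>" if "\<sigma> \<in> carrier G" "\<tau> \<in> carrier G" for \<sigma> \<tau>
    proof -
      \<comment> \<open>Nonnegativity of \<open>a\<close> enters here: by \<open>sum\<close> it
        gives \<open>c (\<sigma> \<otimes> \<tau>) \<le> c \<sigma> + c \<tau>\<close>.\<close>
      have "\<lceil>c (\<sigma> \<otimes> \<tau>)\<rceil> \<le> \<lceil>c \<sigma> + c \<tau>\<rceil>"
        using sum[OF that] by (intro ceiling_mono) simp
      also have "\<dots> \<le> \<lceil>c \<sigma>\<rceil> + \<lceil>c \<tau>\<rceil>" by (rule ceiling_add_le)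
      finally show ?thesis by (simp flip: int_r)
    qed
    then show "r \<in> Sl G" using \<open>c \<one> = 0\<close> by (simp add: Sl_def r_def)
  next
    fix \<sigma> assume \<sigma>: "\<sigma> \<in> carrier G"
    have "c \<sigma> + c (inv \<sigma>) = real (a \<sigma> (inv \<sigma>))"
      using sum[OF \<sigma> inv_closed[OF \<sigma>]] \<sigma> \<open>c \<one> = 0\<close> by simp
    then have "int (a \<sigma> (inv \<sigma>)) \<le> int (r \<sigma>) + int (r (inv \<sigma>))"
      "int (r \<sigma>) + int (r (inv \<sigma>)) \<le> int (a \<sigma> (inv \<sigma>)) + 1"
      unfolding int_r by linarith+
    then show "a \<sigma> (inv \<sigma>) \<le> r \<sigma> + r (inv \<sigma>)" "r \<sigma> + r (inv \<sigma>) \<le> Suc (a \<sigma> (inv \<sigma>))"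
      by linarith+
  qed
qed

section \<open>Cocycles with values in the nonzero elements of a field\<close>

lemma (in field) inv_nonzero:
  assumes "x \<in> carrier R - {\<zero>}"
  shows "inv x \<in> carrier R - {\<zero>}" "x \<otimes> inv x = \<one>" "inv x \<otimes> x = \<one>"
  using assms field_Units Units_inv_Units Units_r_inv Units_l_inv by auto

lemma (in field) inv_mult_nonzero:
  assumes "x \<in> carrier R - {\<zero>}" "y \<in> carrier R - {\<zero>}"
  shows "inv (x \<otimes> y) = inv x \<otimes> inv y"
proof -
  note x = inv_nonzero[OF assms(1)] and y = inv_nonzero[OF assms(2)]
  have "x \<otimes> y \<otimes> (inv x \<otimes> inv y) = (x \<otimes> inv x) \<otimes> (y \<otimes> inv y)"
    using x(1) y(1) assms by (simp add: m_ac)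
  then show ?thesis
    using comm_inv_char[of "x \<otimes> y" "inv x \<otimes> inv y"] x y assms by simp
qed

lemma (in field) hom_inv_nonzero:
  assumes "h \<in> ring_hom R R" "x \<in> carrier R - {\<zero>}"
  shows "h x \<in> carrier R - {\<zero>}" "h (inv x) = inv (h x)"
proof -
  have x: "x \<in> carrier R" "inv x \<in> carrier R" "x \<otimes> inv x = \<one>"
    using inv_nonzero[OF assms(2)] assms(2) by auto
  then have h: "h x \<in> carrier R" "h (inv x) \<in> carrier R" "h x \<otimes> h (inv x) = \<one>"
    using ring_hom_closed[OF assms(1)] ring_hom_mult[OF assms(1) x(1,2)] ring_hom_one[OF assms(1)]
    by auto
  then show "h x \<in> carrier R - {\<zero>}" by auto
  show "h (inv x) = inv (h x)"
    using comm_inv_char[OF h] by simp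
qed

lemma Z2_divide:
  assumes "field L" and G: "G = galois_group L K" "K \<subseteq> carrier L"
    and b: "b \<in> Z2 G L (carrier L - {\<zero>\<^bsub>L\<^esub>})" and f: "f \<in> Z2 G L (carrier L - {\<zero>\<^bsub>L\<^esub>})"
  shows "(\<lambda>\<sigma> \<tau>. b \<sigma> \<tau> \<otimes>\<^bsub>L\<^esub> inv\<^bsub>L\<^esub> f \<sigma> \<tau>) \<in> Z2 G L (carrier L - {\<zero>\<^bsub>L\<^esub>})"
proof -
  interpret L: field L by fact
  interpret G: group G using group_galois_group[OF L.ring_axioms G(2)] G(1) by simp
  let ?U = "carrier L - {\<zero>\<^bsub>L\<^esub>}"
  have U: "b \<sigma> \<tau> \<in> ?U" "f \<sigma> \<tau> \<in> ?U" "inv\<^bsub>L\<^esub> f \<sigma> \<tau> \<in> ?U"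
    if "\<sigma> \<in> carrier G" "\<tau> \<in> carrier G" for \<sigma> \<tau>
    using that b f L.inv_nonzero by (auto simp: Z2_def)
  show ?thesis
    unfolding Z2_def
  proof (intro CollectI conjI ballI)
    fix \<sigma> \<tau> assume "\<sigma> \<in> carrier G" "\<tau> \<in> carrier G"
    then show "b \<sigma> \<tau> \<otimes>\<^bsub>L\<^esub> inv\<^bsub>L\<^esub> f \<sigma> \<tau> \<in> ?U"
      using U L.integral_iff by auto
  next
    fix \<sigma> assume "\<sigma> \<in> carrier G"
    then show "b \<one>\<^bsub>G\<^esub> \<sigma> \<otimes>\<^bsub>L\<^esub> inv\<^bsub>L\<^esub> f \<one>\<^bsub>G\<^esub> \<sigma> = \<one>\<^bsub>L\<^esub>"
      "b \<sigma> \<one>\<^bsub>G\<^esub> \<otimes>\<^bsub>L\<^esub> inv\<^bsub>L\<^esub> f \<sigma> \<one>\<^bsub>G\<^esub> = \<one>\<^bsub>L\<^esub>"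
      using b f by (auto simp: Z2_def)
  next
    fix \<sigma> \<tau> \<rho> assume mem: "\<sigma> \<in> carrier G" "\<tau> \<in> carrier G" "\<rho> \<in> carrier G"
    have \<sigma>: "\<sigma> \<in> ring_hom L L" using galois_group_carrierD(1) mem(1) G(1) by blast
    let ?f1 = "f \<sigma> \<tau>" and ?f2 = "f (\<sigma> \<otimes>\<^bsub>G\<^esub> \<tau>) \<rho>" and ?f3 = "\<sigma> (f \<tau> \<rho>)" and ?f4 = "f \<sigma> (\<tau> \<otimes>\<^bsub>G\<^esub> \<rho>)"
    let ?b1 = "b \<sigma> \<tau>" and ?b2 = "b (\<sigma> \<otimes>\<^bsub>G\<^esub> \<tau>) \<rho>" and ?b3 = "\<sigma> (b \<tau> \<rho>)" and ?b4 = "b \<sigma> (\<tau> \<otimes>\<^bsub>G\<^esub> \<rho>)"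
    have f': "?f1 \<in> ?U" "?f2 \<in> ?U" "?f3 \<in> ?U" "?f4 \<in> ?U"
      and b': "?b1 \<in> ?U" "?b2 \<in> ?U" "?b3 \<in> ?U" "?b4 \<in> ?U"
      by (intro U L.hom_inv_nonzero(1)[OF \<sigma>] G.m_closed mem)+
    note Units = f'[folded L.field_Units] b'[folded L.field_Units]
    have eq: "?f1 \<otimes>\<^bsub>L\<^esub> ?f2 = ?f3 \<otimes>\<^bsub>L\<^esub> ?f4" "?b1 \<otimes>\<^bsub>L\<^esub> ?b2 = ?b3 \<otimes>\<^bsub>L\<^esub> ?b4"
      using b f mem by (auto simp: Z2_def)
    \<comment> \<open>Numerators and denominators are collected so that both cocycle identities
      apply, and are then separated again.\<close>
    have "?b1 \<otimes>\<^bsub>L\<^esub> inv\<^bsub>L\<^esub> ?f1 \<otimes>\<^bsub>L\<^esub> (?b2 \<otimes>\<^bsub>L\<^esub> inv\<^bsub>L\<^esub> ?f2) = (?b1 \<otimes>\<^bsub>L\<^esub> ?b2) \<otimes>\<^bsub>L\<^esub> inv\<^bsub>L\<^esub> (?f1 \<otimes>\<^bsub>L\<^esub> ?f2)"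
      using Units[THEN L.Units_closed] Units[THEN L.Units_inv_closed]
      by (simp add: L.inv_mult_nonzero[OF f'(1,2)] L.m_ac)
    also have "\<dots> = ?b3 \<otimes>\<^bsub>L\<^esub> inv\<^bsub>L\<^esub> ?f3 \<otimes>\<^bsub>L\<^esub> (?b4 \<otimes>\<^bsub>L\<^esub> inv\<^bsub>L\<^esub> ?f4)"
      unfolding eq using Units[THEN L.Units_closed] Units[THEN L.Units_inv_closed]
      by (simp add: L.inv_mult_nonzero[OF f'(3,4)] L.m_ac)
    also have "?b3 \<otimes>\<^bsub>L\<^esub> inv\<^bsub>L\<^esub> ?f3 = \<sigma> (b \<tau> \<rho> \<otimes>\<^bsub>L\<^esub> inv\<^bsub>L\<^esub> f \<tau> \<rho>)"
      using ring_hom_mult[OF \<sigma>, of "b \<tau> \<rho>" "inv\<^bsub>L\<^esub> f \<tau> \<rho>"] U[OF mem(2,3)]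
        L.hom_inv_nonzero(2)[OF \<sigma>, of "f \<tau> \<rho>"] by auto
    finally show "?b1 \<otimes>\<^bsub>L\<^esub> inv\<^bsub>L\<^esub> ?f1 \<otimes>\<^bsub>L\<^esub> (?b2 \<otimes>\<^bsub>L\<^esub> inv\<^bsub>L\<^esub> ?f2) =
      \<sigma> (b \<tau> \<rho> \<otimes>\<^bsub>L\<^esub> inv\<^bsub>L\<^esub> f \<tau> \<rho>) \<otimes>\<^bsub>L\<^esub> (?b4 \<otimes>\<^bsub>L\<^esub> inv\<^bsub>L\<^esub> ?f4)" .
  qed
qed

text \<open>Unit means unit of the field here; that \<open>u L \<pi> \<sigma>\<close> is a unit of
  \<open>S\<close> depends on the uniformizer and is established in
  \<open>v_b_cocycle\<close>.\<close>

lemma u_unit: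
  assumes "field L" "\<sigma> \<in> ring_hom L L" "\<pi> \<in> carrier L - {\<zero>\<^bsub>L\<^esub>}"
  shows "u L \<pi> \<sigma> \<in> carrier L - {\<zero>\<^bsub>L\<^esub>}" "u L \<pi> \<sigma> \<otimes>\<^bsub>L\<^esub> \<pi> = \<sigma> \<pi>"
proof -
  interpret L: field L by fact
  show "u L \<pi> \<sigma> \<in> carrier L - {\<zero>\<^bsub>L\<^esub>}" "u L \<pi> \<sigma> \<otimes>\<^bsub>L\<^esub> \<pi> = \<sigma> \<pi>"
    using L.hom_inv_nonzero(1)[OF assms(2,3)] L.inv_nonzero[OF assms(3)] assms(3) L.integral_iff
    by (auto simp: u_def L.m_assoc)
qed

text \<open>The coboundary of \<open>\<sigma> \<mapsto> \<pi> [^] r \<sigma>\<close>, with the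
  denominator cleared. It rests on
  \<open>\<sigma> \<pi> = u L \<pi> \<sigma> \<otimes> \<pi>\<close>; subadditivity of
  \<open>r\<close> keeps the exponent from truncating, so the powers of \<open>\<pi>\<close>
  recombine.\<close>

lemma b_cocycle_coboundary:
  assumes "field L" and G: "G = galois_group L K" and r: "r \<in> Sl G"
    and \<pi>: "\<pi> \<in> carrier L - {\<zero>\<^bsub>L\<^esub>}" and mem: "\<sigma> \<in> carrier G" "\<tau> \<in> carrier G"
  shows "b_cocycle G L \<pi> r \<sigma> \<tau> \<otimes>\<^bsub>L\<^esub> \<pi> [^]\<^bsub>L\<^esub> r (\<sigma> \<otimes>\<^bsub>G\<^esub> \<tau>) = \<pi> [^]\<^bsub>L\<^esub> r \<sigma> \<otimes>\<^bsub>L\<^esub> \<sigma> (\<pi> [^]\<^bsub>L\<^esub> r \<tau>)"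
proof -
  interpret L: field L by fact
  have \<sigma>: "\<sigma> \<in> ring_hom L L" using galois_group_carrierD(1) mem(1) G by blast
  then interpret \<sigma>: ring_hom_ring L L \<sigma>
    using L.ring_axioms by (simp add: ring_hom_ring.intro ring_hom_ring_axioms_def)
  note u = u_unit[OF assms(1) \<sigma> \<pi>]
  have le: "r (\<sigma> \<otimes>\<^bsub>G\<^esub> \<tau>) \<le> r \<sigma> + r \<tau>" using r mem by (simp add: Sl_def)
  have "b_cocycle G L \<pi> r \<sigma> \<tau> \<otimes>\<^bsub>L\<^esub> \<pi> [^]\<^bsub>L\<^esub> r (\<sigma> \<otimes>\<^bsub>G\<^esub> \<tau>) =
    u L \<pi> \<sigma> [^]\<^bsub>L\<^esub> r \<tau> \<otimes>\<^bsub>L\<^esub> \<pi> [^]\<^bsub>L\<^esub> (r \<sigma> + r \<tau>)"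
    using u(1) \<pi> le L.nat_pow_mult[of \<pi> "r \<sigma> + r \<tau> - r (\<sigma> \<otimes>\<^bsub>G\<^esub> \<tau>)" "r (\<sigma> \<otimes>\<^bsub>G\<^esub> \<tau>)"]
    by (simp add: b_cocycle_def L.m_assoc)
  also have "\<dots> = \<pi> [^]\<^bsub>L\<^esub> r \<sigma> \<otimes>\<^bsub>L\<^esub> (u L \<pi> \<sigma> \<otimes>\<^bsub>L\<^esub> \<pi>) [^]\<^bsub>L\<^esub> r \<tau>"
    using u(1) \<pi> by (simp add: L.nat_pow_mult[symmetric] L.nat_pow_distrib L.m_ac)
  finally show ?thesis using u(2) \<pi> \<sigma>.hom_nat_pow by simp
qed

text \<open>Multiplied by \<open>c\<close> at the triple product, both sides of the cocycle identity
  become \<open>c \<sigma> \<otimes> \<sigma> (c \<tau>) \<otimes> \<sigma> (\<tau> (c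
  \<rho>))\<close>; the nonzero factor is then cancelled.\<close>

lemma b_cocycle_Z2:
  assumes "field L" and G: "G = galois_group L K" "K \<subseteq> carrier L" and r: "r \<in> Sl G"
    and \<pi>: "\<pi> \<in> carrier L - {\<zero>\<^bsub>L\<^esub>}"
  shows "b_cocycle G L \<pi> r \<in> Z2 G L (carrier L - {\<zero>\<^bsub>L\<^esub>})"
proof -
  interpret L: field L by fact
  interpret G: group G using group_galois_group[OF L.ring_axioms G(2)] G(1) by simp
  let ?U = "carrier L - {\<zero>\<^bsub>L\<^esub>}" and ?b = "b_cocycle G L \<pi> r"
  define c where "c \<sigma> = \<pi> [^]\<^bsub>L\<^esub> r \<sigma>" for \<sigma>
  have c: "c \<sigma> \<in> ?U" for \<sigma> using \<pi> L.nat_pow_nonzero by (simp add: c_def)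
  have hom: "\<sigma> \<in> ring_hom L L" if "\<sigma> \<in> carrier G" for \<sigma>
    using galois_group_carrierD(1) that G by blast
  have b: "?b \<sigma> \<tau> \<in> ?U" if "\<sigma> \<in> carrier G" "\<tau> \<in> carrier G" for \<sigma> \<tau>
    using u_unit(1)[OF assms(1) hom \<pi>] that \<pi> L.nat_pow_nonzero L.integral_iff
    by (simp add: b_cocycle_def)
  have cob: "?b \<sigma> \<tau> \<otimes>\<^bsub>L\<^esub> c (\<sigma> \<otimes>\<^bsub>G\<^esub> \<tau>) = c \<sigma> \<otimes>\<^bsub>L\<^esub> \<sigma> (c \<tau>)"
    if "\<sigma> \<in> carrier G" "\<tau> \<in> carrier G" for \<sigma> \<tau>
    unfolding c_def using b_cocycle_coboundary[OF assms(1) G(1) r \<pi> that] .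
  show ?thesis
    unfolding Z2_def
  proof (intro CollectI conjI ballI b)
    fix \<sigma> assume \<sigma>: "\<sigma> \<in> carrier G"
    have "u L \<pi> \<one>\<^bsub>G\<^esub> = \<one>\<^bsub>L\<^esub>"
      using \<pi> L.inv_nonzero(2)[OF \<pi>] by (simp add: u_def G(1) galois_group_one)
    then show "?b \<one>\<^bsub>G\<^esub> \<sigma> = \<one>\<^bsub>L\<^esub>" "?b \<sigma> \<one>\<^bsub>G\<^esub> = \<one>\<^bsub>L\<^esub>"
      using r \<sigma> by (simp_all add: b_cocycle_def Sl_def)
  next
    fix \<sigma> \<tau> \<rho> assume mem: "\<sigma> \<in> carrier G" "\<tau> \<in> carrier G" "\<rho> \<in> carrier G"
    note \<sigma> = hom[OF mem(1)] and \<tau> = hom[OF mem(2)]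
    let ?s = "\<sigma> \<otimes>\<^bsub>G\<^esub> \<tau>" and ?t = "\<tau> \<otimes>\<^bsub>G\<^esub> \<rho>"
    have car: "?b \<sigma> \<tau> \<in> carrier L" "?b ?s \<rho> \<in> carrier L" "?b \<sigma> ?t \<in> carrier L" "?b \<tau> \<rho> \<in> carrier L"
      "\<sigma> (?b \<tau> \<rho>) \<in> carrier L" "\<And>\<phi>. c \<phi> \<in> carrier L" "\<tau> (c \<rho>) \<in> carrier L" "\<sigma> (\<tau> (c \<rho>)) \<in> carrier L"
      "\<And>\<phi>. \<sigma> (c \<phi>) \<in> carrier L"
      using b c mem ring_hom_closed[OF \<sigma>] ring_hom_closed[OF \<tau>] by auto
    \<comment> \<open>The group product is composition restricted to \<open>carrier L\<close>, so
      membership of \<open>c \<rho>\<close> matters.\<close>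
    have comp: "?s (c \<rho>) = \<sigma> (\<tau> (c \<rho>))"
      using galois_group_mult[of \<sigma> L K \<tau>] mem G(1) car by (simp add: compose_eq)
    have "(?b \<sigma> \<tau> \<otimes>\<^bsub>L\<^esub> ?b ?s \<rho>) \<otimes>\<^bsub>L\<^esub> c (?s \<otimes>\<^bsub>G\<^esub> \<rho>) = ?b \<sigma> \<tau> \<otimes>\<^bsub>L\<^esub> (c ?s \<otimes>\<^bsub>L\<^esub> \<sigma> (\<tau> (c \<rho>)))"
      using cob[of ?s \<rho>] mem car comp by (simp add: L.m_assoc)
    also have "\<dots> = c \<sigma> \<otimes>\<^bsub>L\<^esub> (\<sigma> (c \<tau>) \<otimes>\<^bsub>L\<^esub> \<sigma> (\<tau> (c \<rho>)))"
      using cob[of \<sigma> \<tau>] mem car by (simp add: L.m_assoc[symmetric])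
    also have "\<sigma> (c \<tau>) \<otimes>\<^bsub>L\<^esub> \<sigma> (\<tau> (c \<rho>)) = \<sigma> (?b \<tau> \<rho>) \<otimes>\<^bsub>L\<^esub> \<sigma> (c ?t)"
      using cob[of \<tau> \<rho>] mem car by (simp add: ring_hom_mult[OF \<sigma>, symmetric])
    also have "c \<sigma> \<otimes>\<^bsub>L\<^esub> (\<sigma> (?b \<tau> \<rho>) \<otimes>\<^bsub>L\<^esub> \<sigma> (c ?t)) = \<sigma> (?b \<tau> \<rho>) \<otimes>\<^bsub>L\<^esub> (c \<sigma> \<otimes>\<^bsub>L\<^esub> \<sigma> (c ?t))"
      using car by (simp add: L.m_lcomm)
    also have "\<dots> = (\<sigma> (?b \<tau> \<rho>) \<otimes>\<^bsub>L\<^esub> ?b \<sigma> ?t) \<otimes>\<^bsub>L\<^esub> c (\<sigma> \<otimes>\<^bsub>G\<^esub> ?t)"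
      using cob[of \<sigma> ?t] mem car by (simp add: L.m_assoc)
    finally show "?b \<sigma> \<tau> \<otimes>\<^bsub>L\<^esub> ?b ?s \<rho> = \<sigma> (?b \<tau> \<rho>) \<otimes>\<^bsub>L\<^esub> ?b \<sigma> ?t"
      using car c[of "\<sigma> \<otimes>\<^bsub>G\<^esub> ?t"] L.m_rcancel mem by (simp add: G.m_assoc)
  qed
qed

section \<open>Valuations of fractions and of \<open>b_r\<close>\<close>

text \<open>\<open>val\<close> quantifies over all representations as a fraction. Cross-multiplying
  two of them gives an equation in \<open>S\<close>, where multiplicativity of the valuation forces
  equal differences.\<close>

lemma val_fraction:
  assumes "field L" "subring S L" "uniformized_domain (L\<lparr>carrier := S\<rparr>) t"
    and eq: "PIdl\<^bsub>L\<lparr>carrier := S\<rparr>\<^esub> \<pi> = PIdl\<^bsub>L\<lparr>carrier := S\<rparr>\<^esub> t"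
    and xy: "x \<in> S - {\<zero>\<^bsub>L\<^esub>}" "y \<in> S - {\<zero>\<^bsub>L\<^esub>}"
  shows "val L S \<pi> (x \<otimes>\<^bsub>L\<^esub> inv\<^bsub>L\<^esub> y) =
    int (adic_val (L\<lparr>carrier := S\<rparr>) (PIdl\<^bsub>L\<lparr>carrier := S\<rparr>\<^esub> t) x) -
    int (adic_val (L\<lparr>carrier := S\<rparr>) (PIdl\<^bsub>L\<lparr>carrier := S\<rparr>\<^esub> t) y)"
proof -
  interpret L: field L by fact
  interpret B: uniformized_domain "L\<lparr>carrier := S\<rparr>" t by fact
  have S: "S \<subseteq> carrier L" using subringE(1)[OF assms(2)] .
  have uniq: "k = int (B.v x) - int (B.v y)"
    if "a \<in> S - {\<zero>\<^bsub>L\<^esub>}" "b \<in> S - {\<zero>\<^bsub>L\<^esub>}" "x \<otimes>\<^bsub>L\<^esub> inv\<^bsub>L\<^esub> y = a \<otimes>\<^bsub>L\<^esub> inv\<^bsub>L\<^esub> b"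
      "k = int (B.v a) - int (B.v b)" for a b k
  proof -
    have car: "a \<in> carrier L" "b \<in> carrier L" "x \<in> carrier L" "y \<in> carrier L"
      "inv\<^bsub>L\<^esub> b \<in> carrier L" "inv\<^bsub>L\<^esub> y \<in> carrier L"
      "inv\<^bsub>L\<^esub> b \<otimes>\<^bsub>L\<^esub> b = \<one>\<^bsub>L\<^esub>" "inv\<^bsub>L\<^esub> y \<otimes>\<^bsub>L\<^esub> y = \<one>\<^bsub>L\<^esub>"
      using that xy S L.inv_nonzero[of b] L.inv_nonzero[of y] by auto
    have "x \<otimes>\<^bsub>L\<^esub> b = (x \<otimes>\<^bsub>L\<^esub> inv\<^bsub>L\<^esub> y) \<otimes>\<^bsub>L\<^esub> (y \<otimes>\<^bsub>L\<^esub> b)"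
      using car by (metis L.m_assoc L.m_closed L.l_one)
    also have "\<dots> = a \<otimes>\<^bsub>L\<^esub> ((inv\<^bsub>L\<^esub> b \<otimes>\<^bsub>L\<^esub> b) \<otimes>\<^bsub>L\<^esub> y)"
      unfolding that(3) using car(1-6) by (simp add: L.m_ac)
    finally have "x \<otimes>\<^bsub>L\<^esub> b = a \<otimes>\<^bsub>L\<^esub> y" using car by simp
    then have "B.v x + B.v b = B.v a + B.v y"
      using B.v_mult[of x b] B.v_mult[of a y] that(1,2) xy by simp
    with that(4) show ?thesis by simp
  qed
  show ?thesis
    unfolding val_def Let_def eq by (rule the_equality) (use uniq xy in blast)+
qed

text \<open>Write \<open>\<pi> = w \<otimes> t\<close> with \<open>w\<close> a unit of
  \<open>S\<close> and inverse \<open>z\<close>. As \<open>\<sigma>\<close> fixes \<open>t\<close>,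
  \<open>u L \<pi> \<sigma> = \<sigma> w \<otimes> z\<close> is a unit of \<open>S\<close>, so only
  the power of \<open>\<pi>\<close> contributes, and \<open>\<pi>\<close> has valuation 1.\<close>

lemma v_b_cocycle:
  assumes "field L" "subring S L" "uniformized_domain (L\<lparr>carrier := S\<rparr>) t"
    and eq: "PIdl\<^bsub>L\<lparr>carrier := S\<rparr>\<^esub> \<pi> = PIdl\<^bsub>L\<lparr>carrier := S\<rparr>\<^esub> t" and "\<pi> \<in> S"
    and \<sigma>: "\<sigma> \<in> ring_hom L L" "\<sigma> t = t" "\<And>x. x \<in> S \<Longrightarrow> \<sigma> x \<in> S"
  shows "b_cocycle G L \<pi> r \<sigma> \<tau> \<in> S - {\<zero>\<^bsub>L\<^esub>}"
    and "adic_val (L\<lparr>carrier := S\<rparr>) (PIdl\<^bsub>L\<lparr>carrier := S\<rparr>\<^esub> t) (b_cocycle G L \<pi> r \<sigma> \<tau>) =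
      r \<sigma> + r \<tau> - r (\<sigma> \<otimes>\<^bsub>G\<^esub> \<tau>)"
proof -
  let ?B = "L\<lparr>carrier := S\<rparr>"
  interpret L: field L by fact
  interpret B: uniformized_domain ?B t by fact
  have S: "S \<subseteq> carrier L" using subringE(1)[OF assms(2)] .
  have pow: "x [^]\<^bsub>?B\<^esub> n = x [^]\<^bsub>L\<^esub> n" for x and n :: nat
    by (simp add: nat_pow_def)
  obtain w where w: "w \<in> Units ?B" "\<pi> = w \<otimes>\<^bsub>L\<^esub> t"
    using B.associated_iff_same_ideal[of \<pi> t] B.ring_associated_iff[of \<pi> t] eq \<open>\<pi> \<in> S\<close> B.t_closed
    by auto
  obtain z where z: "z \<in> S" "w \<otimes>\<^bsub>L\<^esub> z = \<one>\<^bsub>L\<^esub>"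
    using w(1) by (auto simp: Units_def)
  have car: "w \<in> S" "t \<in> S" "w \<in> carrier L" "z \<in> carrier L" "t \<in> carrier L" "\<sigma> w \<in> S" "\<sigma> z \<in> S"
    using w(1) z(1) S B.t_closed \<sigma>(3) by (auto simp: Units_def)
  have "\<pi> \<noteq> \<zero>\<^bsub>L\<^esub>"
    using B.generator_nonzero[OF eq] by simp
  then have \<pi>: "\<pi> \<in> carrier L - {\<zero>\<^bsub>L\<^esub>}" using \<open>\<pi> \<in> S\<close> S by auto
  have "\<sigma> w \<otimes>\<^bsub>L\<^esub> \<sigma> z = \<one>\<^bsub>L\<^esub>"
    using ring_hom_mult[OF \<sigma>(1) car(3,4)] z(2) ring_hom_one[OF \<sigma>(1)] by simp
  then have u_B: "\<sigma> w \<otimes>\<^bsub>L\<^esub> z \<in> Units ?B"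
    using B.unit_factor[of "\<sigma> w" "\<sigma> z"] B.unit_factor[of z w] B.Units_m_closed[of "\<sigma> w" z]
      car z S B.Units_one_closed L.m_comm[of w z] by auto
  have "u L \<pi> \<sigma> \<otimes>\<^bsub>L\<^esub> \<pi> = \<sigma> w \<otimes>\<^bsub>L\<^esub> z \<otimes>\<^bsub>L\<^esub> \<pi>"
  proof -
    have "\<sigma> w \<otimes>\<^bsub>L\<^esub> z \<otimes>\<^bsub>L\<^esub> \<pi> = \<sigma> w \<otimes>\<^bsub>L\<^esub> ((w \<otimes>\<^bsub>L\<^esub> z) \<otimes>\<^bsub>L\<^esub> t)"
      unfolding w(2) using car(3-6) S by (simp add: L.m_ac subset_iff)
    also have "\<dots> = \<sigma> \<pi>"
      using z(2) car S \<sigma>(2) ring_hom_mult[OF \<sigma>(1) car(3,5)] by (simp add: w(2))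
    finally show ?thesis using u_unit(2)[OF assms(1) \<sigma>(1) \<pi>] by simp
  qed
  then have "u L \<pi> \<sigma> = \<sigma> w \<otimes>\<^bsub>L\<^esub> z"
    using L.m_rcancel[of \<pi> "u L \<pi> \<sigma>" "\<sigma> w \<otimes>\<^bsub>L\<^esub> z"] \<pi> u_unit(1)[OF assms(1) \<sigma>(1) \<pi>]
      S car by auto
  with u_B have u: "u L \<pi> \<sigma> \<in> Units ?B" by simp
  then have u': "u L \<pi> \<sigma> \<in> S" "u L \<pi> \<sigma> \<noteq> \<zero>\<^bsub>L\<^esub>"
    using u_unit(1)[OF assms(1) \<sigma>(1) \<pi>] by (auto simp: Units_def)
  have v\<pi>: "B.v \<pi> = 1"
    using B.v_mult[of w t] B.v_t B.v_unit[OF w(1)] w(2) car \<open>\<pi> \<noteq> \<zero>\<^bsub>L\<^esub>\<close> B.t_nonzero by force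
  have pow_mem: "x [^]\<^bsub>L\<^esub> n \<in> S" "x [^]\<^bsub>L\<^esub> n \<noteq> \<zero>\<^bsub>L\<^esub>" "B.v (x [^]\<^bsub>L\<^esub> n) = n * B.v x"
    if "x \<in> S" "x \<noteq> \<zero>\<^bsub>L\<^esub>" for x and n :: nat
    using B.nat_pow_closed[of x n] B.nat_pow_nonzero[of x n] B.v_pow[of x n] that by (auto simp: pow)
  note pows = pow_mem[OF u'] pow_mem[OF \<open>\<pi> \<in> S\<close> \<open>\<pi> \<noteq> \<zero>\<^bsub>L\<^esub>\<close>]
  have "x \<otimes>\<^bsub>L\<^esub> y \<in> S - {\<zero>\<^bsub>L\<^esub>}" if "x \<in> S" "x \<noteq> \<zero>\<^bsub>L\<^esub>" "y \<in> S" "y \<noteq> \<zero>\<^bsub>L\<^esub>" for x y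
    using B.m_closed[of x y] B.integral_iff[of x y] that by simp
  then show "b_cocycle G L \<pi> r \<sigma> \<tau> \<in> S - {\<zero>\<^bsub>L\<^esub>}"
    unfolding b_cocycle_def using pows by simp
  show "B.v (b_cocycle G L \<pi> r \<sigma> \<tau>) = r \<sigma> + r \<tau> - r (\<sigma> \<otimes>\<^bsub>G\<^esub> \<tau>)"
    unfolding b_cocycle_def using pows B.v_unit[OF u] v\<pi>
      B.v_mult[of "u L \<pi> \<sigma> [^]\<^bsub>L\<^esub> r \<tau>" "\<pi> [^]\<^bsub>L\<^esub> (r \<sigma> + r \<tau> - r (\<sigma> \<otimes>\<^bsub>G\<^esub> \<tau>))"] by simp
qed

theorem theorem4p7:
  fixes L :: "('a, 'b) ring_scheme" (structure)
    and K R S :: "'a set"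
    and \<pi> :: 'a
    and G :: "('a \<Rightarrow> 'a) monoid"
    and f :: "('a \<Rightarrow> 'a) \<Rightarrow> ('a \<Rightarrow> 'a) \<Rightarrow> 'a"
  assumes "field L" and "subfield K L" and "subring R L"
    and "complete_discrete_valuation_ring (L\<lparr>carrier := R\<rparr>)"
    and "K = quotient_field_in L R"
    and "ring.finite_galois_over L K"
    and "G = galois_group L K"
    and "S = integral_closure_in L R"
    and "\<pi> \<in> S"
    and "{M. maximalideal M (L\<lparr>carrier := S\<rparr>)} = {PIdl\<^bsub>L\<lparr>carrier := S\<rparr>\<^esub> \<pi>}"
    and "unramified_extension (L\<lparr>carrier := R\<rparr>) (L\<lparr>carrier := S\<rparr>)"
    and "finite (carrier (L\<lparr>carrier := S\<rparr> Quot (PIdl\<^bsub>L\<lparr>carrier := S\<rparr>\<^esub> \<pi>)))"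
    and "f \<in> Z2 G L (S - {\<zero>})"
  shows "\<exists>h \<in> Z2 G L (carrier L - {\<zero>}). \<exists>r \<in> Sl G.
           (\<forall>\<sigma> \<in> carrier G. \<forall>\<tau> \<in> carrier G. f \<sigma> \<tau> \<otimes> h \<sigma> \<tau> = b_cocycle G L \<pi> r \<sigma> \<tau>) \<and>
           (\<forall>\<sigma> \<in> carrier G. 0 \<le> val L S \<pi> (h \<sigma> (inv\<^bsub>G\<^esub> \<sigma>)) \<and>
                             val L S \<pi> (h \<sigma> (inv\<^bsub>G\<^esub> \<sigma>)) \<le> 1)"
proof -
  let ?B = "L\<lparr>carrier := S\<rparr>"
  interpret L: field L by fact
  have K: "K \<subseteq> carrier L" using subfieldE(3)[OF assms(2)] .
  interpret G: group G using group_galois_group[OF L.ring_axioms K] assms(7) by simp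
  have dvr: "discrete_valuation_ring (L\<lparr>carrier := R\<rparr>)"
    using assms(4) by (simp add: complete_discrete_valuation_ring_def)
  obtain t where "subring S L" "t \<in> R" and unif: "uniformized_domain ?B t"
    and eq: "PIdl\<^bsub>?B\<^esub> \<pi> = PIdl\<^bsub>?B\<^esub> t"
    using integral_closure_uniformizer[OF assms(1,3) dvr assms(8,10,11)] .
  interpret B: uniformized_domain ?B t by (rule unif)
  have S: "S \<subseteq> carrier L" using subringE(1)[OF \<open>subring S L\<close>] .
  \<comment> \<open>Members of \<open>G\<close> are given as fixing \<open>K\<close>; this inclusion
    makes them fix \<open>R\<close>, and with it \<open>t\<close>.\<close>
  have "R \<subseteq> K"
  proof
    fix a assume "a \<in> R"
    moreover have "a = a \<otimes> inv \<one>" using subringE(1)[OF assms(3)] \<open>a \<in> R\<close> by auto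
    ultimately show "a \<in> K"
      unfolding assms(5) quotient_field_in_def using subringE(3)[OF assms(3)] L.one_not_zero by blast
  qed
  have hom: "\<sigma> \<in> ring_hom L L" and fix_R: "\<And>a. a \<in> R \<Longrightarrow> \<sigma> a = a" if "\<sigma> \<in> carrier G" for \<sigma>
    using galois_group_carrierD[of \<sigma> L K] that assms(7) \<open>R \<subseteq> K\<close> by auto
  have hom_S: "\<sigma> x \<in> S" if "\<sigma> \<in> carrier G" "x \<in> S" for \<sigma> x
    using integral_closure_in_hom_closed[OF L.ring_axioms assms(3) hom fix_R] that assms(8) by simp
  have v_hom: "B.v (\<sigma> x) = B.v x" if "\<sigma> \<in> carrier G" "x \<in> S - {\<zero>}" for \<sigma> x
  proof -
    \<comment> \<open>\<open>B.v_hom\<close> concerns endomorphisms of \<open>S\<close>, so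
      \<open>\<sigma>\<close> is first seen to act on \<open>S\<close>.\<close>
    have "\<sigma> \<in> ring_hom ?B ?B"
      using hom_S[OF that(1)] ring_hom_one[OF hom] ring_hom_mult[OF hom] ring_hom_add[OF hom] that(1) S
      by (intro ring_hom_memI) (auto simp: subset_iff)
    then show ?thesis using B.v_hom[of \<sigma> x] fix_R[OF that(1) \<open>t \<in> R\<close>] that(2) by simp
  qed
  have f_mem: "f \<sigma> \<tau> \<in> S - {\<zero>}" if "\<sigma> \<in> carrier G" "\<tau> \<in> carrier G" for \<sigma> \<tau>
    using assms(13) that by (auto simp: Z2_def)
  have f_Z2: "f \<in> Z2 G L (carrier L - {\<zero>})"
    using assms(13) S by (auto simp: Z2_def)
  have "finite (carrier G)"
    using finite_galois_group[OF assms(1,2,6)] assms(7) by simp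
  moreover have "B.v (f \<sigma> \<tau>) + B.v (f (\<sigma> \<otimes>\<^bsub>G\<^esub> \<tau>) \<rho>) = B.v (f \<tau> \<rho>) + B.v (f \<sigma> (\<tau> \<otimes>\<^bsub>G\<^esub> \<rho>))"
    if mem: "\<sigma> \<in> carrier G" "\<tau> \<in> carrier G" "\<rho> \<in> carrier G" for \<sigma> \<tau> \<rho>
  proof -
    have "f \<sigma> \<tau> \<otimes> f (\<sigma> \<otimes>\<^bsub>G\<^esub> \<tau>) \<rho> = \<sigma> (f \<tau> \<rho>) \<otimes> f \<sigma> (\<tau> \<otimes>\<^bsub>G\<^esub> \<rho>)"
      using assms(13) mem by (auto simp: Z2_def)
    moreover have "\<sigma> (f \<tau> \<rho>) \<in> S - {\<zero>}"
      using hom_S[OF mem(1)] f_mem[OF mem(2,3)] L.hom_inv_nonzero(1)[OF hom[OF mem(1)], of "f \<tau> \<rho>"] S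
      by auto
    ultimately show ?thesis
      using B.v_mult[of "f \<sigma> \<tau>" "f (\<sigma> \<otimes>\<^bsub>G\<^esub> \<tau>) \<rho>"] f_mem[OF mem(1,2)] f_mem[of "\<sigma> \<otimes>\<^bsub>G\<^esub> \<tau>" \<rho>]
        B.v_mult[of "\<sigma> (f \<tau> \<rho>)" "f \<sigma> (\<tau> \<otimes>\<^bsub>G\<^esub> \<rho>)"] f_mem[of \<sigma> "\<tau> \<otimes>\<^bsub>G\<^esub> \<rho>"] mem
        v_hom[OF mem(1) f_mem[OF mem(2,3)]] by simp
  qed
  moreover have "B.v (f \<one>\<^bsub>G\<^esub> \<rho>) = 0" if "\<rho> \<in> carrier G" for \<rho>
    using assms(13) that B.v_unit[of \<one>] B.Units_one_closed by (simp add: Z2_def)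
  ultimately obtain r where r: "r \<in> Sl G"
    and r_ge: "\<And>\<sigma>. \<sigma> \<in> carrier G \<Longrightarrow> B.v (f \<sigma> (inv\<^bsub>G\<^esub> \<sigma>)) \<le> r \<sigma> + r (inv\<^bsub>G\<^esub> \<sigma>)"
    and r_le: "\<And>\<sigma>. \<sigma> \<in> carrier G \<Longrightarrow> r \<sigma> + r (inv\<^bsub>G\<^esub> \<sigma>) \<le> Suc (B.v (f \<sigma> (inv\<^bsub>G\<^esub> \<sigma>)))"
    using G.nat_cocycle_Sl[of "\<lambda>\<sigma> \<tau>. B.v (f \<sigma> \<tau>)"] by blast
  let ?b = "b_cocycle G L \<pi> r" and ?h = "\<lambda>\<sigma> \<tau>. b_cocycle G L \<pi> r \<sigma> \<tau> \<otimes> inv (f \<sigma> \<tau>)"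
  have \<pi>: "\<pi> \<in> carrier L - {\<zero>}"
    using assms(9) S B.generator_nonzero[OF eq] by auto
  have b_mem: "?b \<sigma> \<tau> \<in> S - {\<zero>}" and v_b: "B.v (?b \<sigma> \<tau>) = r \<sigma> + r \<tau> - r (\<sigma> \<otimes>\<^bsub>G\<^esub> \<tau>)"
    if "\<sigma> \<in> carrier G" for \<sigma> \<tau>
    using v_b_cocycle[OF assms(1) \<open>subring S L\<close> unif eq assms(9) hom[OF that]
        fix_R[OF that \<open>t \<in> R\<close>] hom_S[OF that]] by blast+
  have h_Z2: "?h \<in> Z2 G L (carrier L - {\<zero>})"
    using Z2_divide[OF assms(1,7) K b_cocycle_Z2[OF assms(1,7) K r \<pi>] f_Z2] .
  have h_prod: "f \<sigma> \<tau> \<otimes> ?h \<sigma> \<tau> = ?b \<sigma> \<tau>" if "\<sigma> \<in> carrier G" "\<tau> \<in> carrier G" for \<sigma> \<tau>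
    using b_mem[OF that(1), of \<tau>] f_mem[OF that] S L.inv_nonzero[of "f \<sigma> \<tau>"]
      L.m_lcomm[of "f \<sigma> \<tau>" "?b \<sigma> \<tau>" "inv (f \<sigma> \<tau>)"] by auto
  have h_val: "0 \<le> val L S \<pi> (?h \<sigma> (inv\<^bsub>G\<^esub> \<sigma>)) \<and> val L S \<pi> (?h \<sigma> (inv\<^bsub>G\<^esub> \<sigma>)) \<le> 1"
    if \<sigma>: "\<sigma> \<in> carrier G" for \<sigma>
  proof -
    \<comment> \<open>So \<open>b_r\<close> has valuation
      \<open>r \<sigma> + r (inv \<sigma>)\<close> here, and subtracting that of \<open>f\<close>
      leaves the excess 0 or 1 found for \<open>r\<close>.\<close>
    have "r (\<sigma> \<otimes>\<^bsub>G\<^esub> inv\<^bsub>G\<^esub> \<sigma>) = 0"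
      using r \<sigma> by (simp add: Sl_def)
    then show ?thesis
      using val_fraction[OF assms(1) \<open>subring S L\<close> unif eq b_mem[OF \<sigma>] f_mem[OF \<sigma> G.inv_closed[OF \<sigma>]]]
        v_b[OF \<sigma>] r_ge[OF \<sigma>] r_le[OF \<sigma>] by simp
  qed
  show ?thesis
    by (intro bexI[OF _ h_Z2] bexI[OF _ r] conjI ballI h_prod
        h_val[THEN conjunct1] h_val[THEN conjunct2])
qed

end
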